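(* Let $\mathsf{C}$ be a small category with operadic version $\mathcal{C}$ and let $\mathcal{C}_\infty=(\mathbb{F}(F),\partial)\to(\mathcal{C},0)$ be a free resolution satisfying Assumptions (i), (ii) of the context. Then for every integer $n\ge1$ there is a linear map $[[-]]_n:\mathcal{C}_\infty\to\mathcal{C}_\infty^{\otimes n}$ satisfying, for all $r,r'\in\mathcal{C}_\infty$ (homogeneous in colours and degree where these are referred to, and composable in (C5)): (C1) $[[r]]_n$ is $\Sigma_n$-stable (invariant); (C2) $[[r]]_n\in\mathcal{C}_\infty\binom{O(r)}{I(r)}^{\otimes n}$; (C3) $\deg[[r]]_n=\deg r$; (C4) $[[f]]_n=f^{\otimes n}$ for every $f\in M\subset F_0$; (C5) $[[r\circ r']]_n=[[r]]_n\circ[[r']]_n$; (C6) $\partial[[r]]_n=[[\partial r]]_n$.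
   Context: $k$ is a field of characteristic $0$; $k\langle S\rangle$ is the $k$-span of $S$; complexes are non-negatively graded with differential of degree $-1$; a quism is a quasi-isomorphism. Let $V=\mathrm{Ob}\,\mathsf{C}$; for a morphism $f$, $I(f)$ is its source and $O(f)$ its target. $\mathcal{C}=k\langle\mathrm{Mor}\,\mathsf{C}\rangle$ is the $V$-coloured operad concentrated in arity $1$ and degree $0$ with $f\in\mathcal{C}\binom{O(f)}{I(f)}$ (output colour on top, input colour below) and composition that of $\mathsf{C}$. A $V$-operad concentrated in arity $1$ is a $V$-coloured unital associative algebra with partially defined product. A free resolution of $\mathcal{C}$ is a quism of dg $V$-operads $(\mathbb{F}(F),\partial)\to(\mathcal{C},0)$, where $\mathbb{F}(F)$ is the free $V$-operad on a graded $V$-coloured module $F=\bigoplus_{i\ge0}F_i$ concentrated in arity $1$. Assumptions: (i) $F_0=k\langle M\rangle$ for some $M\subset\mathrm{Mor}\,\mathsf{C}\setminus\{\text{identities}\}$; (ii) $F_1=k\langle R\rangle$, where for each $r\in R$, $\partial r=r_1-r_2$ for some free operadic compositions $r_1,r_2$ of elements of $M\cup\{\text{identities}\}$. For $r\in\mathcal{C}_\infty$ colour-homogeneous, $I(r)$ and $O(r)$ are its input and output colours. $\mathcal{C}_\infty^{\otimes n}$ (tensor over $k$) has the usual tensor product differential; the right $\Sigma_n$-action generated by transpositions: the transposition of $i<j$ exchanges the factors $r_i,r_j$ of $r_1\otimes\cdots\otimes r_n$ with sign $(-1)^{|r_i||r_j|+(|r_i|+|r_j|)\sum_{i<l<j}|r_l|}$;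 and the factorwise composition $(r_1\otimes\cdots\otimes r_n)\circ(s_1\otimes\cdots\otimes s_n)=(-1)^{\sum_{n\ge i>j\ge1}|r_i||s_j|}(r_1s_1)\otimes\cdots\otimes(r_ns_n)$, defined when $I(r_i)=O(s_i)$ for all $i$. *)

theory Defs
  imports "HOL-Library.Poly_Mapping" "HOL-Library.FuncSet"
begin

section \<open>Linear algebra on spans of sets\<close>

text \<open>
  Every vector space below is a span of a set \<open>S\<close> over a field \<open>'k\<close>, realised as the finitely
  supported functions with support in \<open>S\<close>; the basis vector of \<open>x\<close> is \<open>Poly_Mapping.single x 1\<close>.
\<close>

definition kspan :: "'a set \<Rightarrow> ('a \<Rightarrow>\<^sub>0 'k::zero) set" where
  "kspan S = {p. Poly_Mapping.keys p \<subseteq> S}"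

definition smul :: "'k::field \<Rightarrow> ('a \<Rightarrow>\<^sub>0 'k) \<Rightarrow> ('a \<Rightarrow>\<^sub>0 'k)" where
  "smul c p = Poly_Mapping.map ((*) c) p"

definition klinear ::
  "('a \<Rightarrow>\<^sub>0 'k::field) set \<Rightarrow> ('b \<Rightarrow>\<^sub>0 'k) set \<Rightarrow> (('a \<Rightarrow>\<^sub>0 'k) \<Rightarrow> ('b \<Rightarrow>\<^sub>0 'k)) \<Rightarrow> bool" where
  "klinear A B f \<longleftrightarrow>
     f \<in> A \<rightarrow> B \<and>
     (\<forall>x\<in>A. \<forall>y\<in>A. f (x + y) = f x + f y) \<and>
     (\<forall>c. \<forall>x\<in>A. f (smul c x) = smul c (f x))"

definition lin_ext :: "('a \<Rightarrow> ('b \<Rightarrow>\<^sub>0 'k::field)) \<Rightarrow> ('a \<Rightarrow>\<^sub>0 'k) \<Rightarrow> ('b \<Rightarrow>\<^sub>0 'k)" where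
  "lin_ext f p = (\<Sum>x\<in>Poly_Mapping.keys p. smul (Poly_Mapping.lookup p x) (f x))"

definition bilin_ext ::
  "('a \<Rightarrow> 'b \<Rightarrow> ('c \<Rightarrow>\<^sub>0 'k::field)) \<Rightarrow> ('a \<Rightarrow>\<^sub>0 'k) \<Rightarrow> ('b \<Rightarrow>\<^sub>0 'k) \<Rightarrow> ('c \<Rightarrow>\<^sub>0 'k)" where
  "bilin_ext f p q = lin_ext (\<lambda>x. lin_ext (f x) q) p"

text \<open>
  The induced map on homology is bijective in every degree: injectivity is the first
  conjunct, surjectivity the second. Differentials lower the degree by one; it is
  understood that they vanish on degree 0.
\<close>

definition cycles :: "(nat \<Rightarrow> 'a::ab_group_add set) \<Rightarrow> ('a \<Rightarrow> 'a) \<Rightarrow> nat \<Rightarrow> 'a set" where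
  "cycles A d i = {z \<in> A i. d z = 0}"

definition boundaries :: "(nat \<Rightarrow> 'a::ab_group_add set) \<Rightarrow> ('a \<Rightarrow> 'a) \<Rightarrow> nat \<Rightarrow> 'a set" where
  "boundaries A d i = d ` A (Suc i)"

definition homology_iso ::
  "(nat \<Rightarrow> 'a::ab_group_add set) \<Rightarrow> ('a \<Rightarrow> 'a) \<Rightarrow> (nat \<Rightarrow> 'b::ab_group_add set) \<Rightarrow> ('b \<Rightarrow> 'b) \<Rightarrow>
   ('a \<Rightarrow> 'b) \<Rightarrow> bool" where
  "homology_iso A dA B dB f \<longleftrightarrow>
     (\<forall>i. (\<forall>z\<in>cycles A dA i. f z \<in> boundaries B dB i \<longrightarrow> z \<in> boundaries A dA i) \<and>
          (\<forall>w\<in>cycles B dB i. \<exists>z\<in>cycles A dA i. w - f z \<in> boundaries B dB i))"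

section \<open>Small categories and their operadic version\<close>

record ('o, 'm) category =
  obs :: "'o set"
  mors :: "'m set"
  src :: "'m \<Rightarrow> 'o"
  tgt :: "'m \<Rightarrow> 'o"
  ident :: "'o \<Rightarrow> 'm"
  cmp :: "'m \<Rightarrow> 'm \<Rightarrow> 'm"  \<comment> \<open>\<open>cmp C g f\<close> is \<open>g\<close> after \<open>f\<close>\<close>

locale small_category =
  fixes C :: "('o, 'm) category"
  assumes src_in: "f \<in> mors C \<Longrightarrow> src C f \<in> obs C"
    and tgt_in: "f \<in> mors C \<Longrightarrow> tgt C f \<in> obs C"
    and ident_in: "a \<in> obs C \<Longrightarrow> ident C a \<in> mors C"
    and src_ident: "a \<in> obs C \<Longrightarrow> src C (ident C a) = a"
    and tgt_ident: "a \<in> obs C \<Longrightarrow> tgt C (ident C a) = a"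
    and cmp_in: "\<lbrakk>g \<in> mors C; f \<in> mors C; src C g = tgt C f\<rbrakk> \<Longrightarrow> cmp C g f \<in> mors C"
    and src_cmp: "\<lbrakk>g \<in> mors C; f \<in> mors C; src C g = tgt C f\<rbrakk> \<Longrightarrow> src C (cmp C g f) = src C f"
    and tgt_cmp: "\<lbrakk>g \<in> mors C; f \<in> mors C; src C g = tgt C f\<rbrakk> \<Longrightarrow> tgt C (cmp C g f) = tgt C g"
    and cmp_ident_right: "f \<in> mors C \<Longrightarrow> cmp C f (ident C (src C f)) = f"
    and cmp_ident_left: "f \<in> mors C \<Longrightarrow> cmp C (ident C (tgt C f)) f = f"
    and cmp_assoc: "\<lbrakk>h \<in> mors C; g \<in> mors C; f \<in> mors C; src C h = tgt C g; src C g = tgt C f\<rbrakk>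
                    \<Longrightarrow> cmp C (cmp C h g) f = cmp C h (cmp C g f)"

text \<open>
  In both operads below the partially defined composition is extended by 0 to
  basis elements with mismatched colours, so as to be bilinear on the sum of all components.
\<close>

definition cat_hom :: "('o, 'm) category \<Rightarrow> 'o \<Rightarrow> 'o \<Rightarrow> ('m \<Rightarrow>\<^sub>0 'k::field) set" where
  "cat_hom C b a = kspan {f \<in> mors C. tgt C f = b \<and> src C f = a}"

definition cat_comp ::
  "('o, 'm) category \<Rightarrow> ('m \<Rightarrow>\<^sub>0 'k::field) \<Rightarrow> ('m \<Rightarrow>\<^sub>0 'k) \<Rightarrow> ('m \<Rightarrow>\<^sub>0 'k)" where
  "cat_comp C = bilin_ext (\<lambda>g f. if src C g = tgt C f
                                  then Poly_Mapping.single (cmp C g f) 1 else 0)"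

definition cat_complex :: "('o, 'm) category \<Rightarrow> 'o \<Rightarrow> 'o \<Rightarrow> nat \<Rightarrow> ('m \<Rightarrow>\<^sub>0 'k::field) set" where
  "cat_complex C b a i = (if i = 0 then cat_hom C b a else {0})"

section \<open>The free coloured operad on a graded coloured module, in arity 1\<close>

text \<open>
  A graded \<open>V\<close>-coloured module \<open>F\<close> concentrated in arity 1 is given by a homogeneous basis
  (a graded \<open>V\<close>-coloured set of generators); over a field every such module has one.
  The degree \<open>i\<close> part of \<open>F\<close> is the span of the generators of degree \<open>i\<close>.
\<close>

record ('o, 'g) coloured_basis =
  gens :: "'g set"
  gdeg :: "'g \<Rightarrow> nat"
  gin :: "'g \<Rightarrow> 'o"
  gout :: "'g \<Rightarrow> 'o"

definition coloured_by :: "'o set \<Rightarrow> ('o, 'g) coloured_basis \<Rightarrow> bool" where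
  "coloured_by V F \<longleftrightarrow> (\<forall>g\<in>gens F. gin F g \<in> V \<and> gout F g \<in> V)"

text \<open>
  The word \<open>([g\<^sub>1, \<dots>, g\<^sub>m], a)\<close> stands for the free composite of \<open>g\<^sub>1 \<circ> \<dots> \<circ> g\<^sub>m\<close>
  with input colour \<open>a\<close>; \<open>([], a)\<close> is the operadic unit of colour \<open>a\<close>.
\<close>

type_synonym ('o, 'g) word = "'g list \<times> 'o"

fun word_out :: "('o, 'g) coloured_basis \<Rightarrow> ('o, 'g) word \<Rightarrow> 'o" where
  "word_out F ([], a) = a"
| "word_out F (g # gs, a) = gout F g"

fun word_in :: "('o, 'g) word \<Rightarrow> 'o" where
  "word_in (gs, a) = a"

fun word_deg :: "('o, 'g) coloured_basis \<Rightarrow> ('o, 'g) word \<Rightarrow> nat" where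
  "word_deg F (gs, a) = sum_list (map (gdeg F) gs)"

fun is_word :: "'o set \<Rightarrow> ('o, 'g) coloured_basis \<Rightarrow> ('o, 'g) word \<Rightarrow> bool" where
  "is_word V F ([], a) \<longleftrightarrow> a \<in> V"
| "is_word V F (g # gs, a) \<longleftrightarrow>
     g \<in> gens F \<and> gin F g = word_out F (gs, a) \<and> is_word V F (gs, a)"

fun word_comp :: "('o, 'g) word \<Rightarrow> ('o, 'g) word \<Rightarrow> ('o, 'g) word" where
  "word_comp (gs, b) (hs, a) = (gs @ hs, a)"

definition words :: "'o set \<Rightarrow> ('o, 'g) coloured_basis \<Rightarrow> ('o, 'g) word set" where
  "words V F = {w. is_word V F w}"

definition hom_words :: "'o set \<Rightarrow> ('o, 'g) coloured_basis \<Rightarrow> 'o \<Rightarrow> 'o \<Rightarrow> ('o, 'g) word set" where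
  "hom_words V F b a = {w \<in> words V F. word_out F w = b \<and> word_in w = a}"

definition deg_words :: "'o set \<Rightarrow> ('o, 'g) coloured_basis \<Rightarrow> nat \<Rightarrow> ('o, 'g) word set" where
  "deg_words V F i = {w \<in> words V F. word_deg F w = i}"

definition free_operad ::
  "'o set \<Rightarrow> ('o, 'g) coloured_basis \<Rightarrow> (('o, 'g) word \<Rightarrow>\<^sub>0 'k::field) set" where
  "free_operad V F = kspan (words V F)"

text \<open>The component with output colour \<open>b\<close> and input colour \<open>a\<close>.\<close>

definition free_hom ::
  "'o set \<Rightarrow> ('o, 'g) coloured_basis \<Rightarrow> 'o \<Rightarrow> 'o \<Rightarrow> (('o, 'g) word \<Rightarrow>\<^sub>0 'k::field) set" where
  "free_hom V F b a = kspan (hom_words V F b a)"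

definition free_deg ::
  "'o set \<Rightarrow> ('o, 'g) coloured_basis \<Rightarrow> nat \<Rightarrow> (('o, 'g) word \<Rightarrow>\<^sub>0 'k::field) set" where
  "free_deg V F i = kspan (deg_words V F i)"

definition free_complex ::
  "'o set \<Rightarrow> ('o, 'g) coloured_basis \<Rightarrow> 'o \<Rightarrow> 'o \<Rightarrow> nat \<Rightarrow> (('o, 'g) word \<Rightarrow>\<^sub>0 'k::field) set" where
  "free_complex V F b a i = free_hom V F b a \<inter> free_deg V F i"

definition free_comp ::
  "('o, 'g) coloured_basis \<Rightarrow> (('o, 'g) word \<Rightarrow>\<^sub>0 'k::field) \<Rightarrow> (('o, 'g) word \<Rightarrow>\<^sub>0 'k) \<Rightarrow>
   (('o, 'g) word \<Rightarrow>\<^sub>0 'k)" where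
  "free_comp F = bilin_ext (\<lambda>u w. if word_in u = word_out F w
                                   then Poly_Mapping.single (word_comp u w) 1 else 0)"

definition unit_elem :: "'o \<Rightarrow> (('o, 'g) word \<Rightarrow>\<^sub>0 'k::field)" where
  "unit_elem a = Poly_Mapping.single ([], a) 1"

definition gen_elem :: "('o, 'g) coloured_basis \<Rightarrow> 'g \<Rightarrow> (('o, 'g) word \<Rightarrow>\<^sub>0 'k::field)" where
  "gen_elem F g = Poly_Mapping.single ([g], gin F g) 1"

locale dg_free_operad =
  fixes V :: "'o set"
    and F :: "('o, 'g) coloured_basis"
    and d :: "(('o, 'g) word \<Rightarrow>\<^sub>0 'k::field) \<Rightarrow> (('o, 'g) word \<Rightarrow>\<^sub>0 'k)"
  assumes coloured: "coloured_by V F"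
    and d_linear: "klinear (free_operad V F) (free_operad V F) d"
    and d_colours: "\<lbrakk>a \<in> V; b \<in> V; r \<in> free_hom V F b a\<rbrakk> \<Longrightarrow> d r \<in> free_hom V F b a"
    and d_degree: "r \<in> free_deg V F (Suc i) \<Longrightarrow> d r \<in> free_deg V F i"
    and d_degree_0: "r \<in> free_deg V F 0 \<Longrightarrow> d r = 0"
    and d_square: "r \<in> free_operad V F \<Longrightarrow> d (d r) = 0"
    and d_leibniz: "\<lbrakk>a \<in> V; b \<in> V; c \<in> V; r \<in> free_complex V F c b i; s \<in> free_hom V F b a\<rbrakk>
       \<Longrightarrow> d (free_comp F r s) = free_comp F (d r) s + smul ((-1) ^ i) (free_comp F r (d s))"

text \<open>
  A quasi-isomorphism \<open>\<pi>\<close> of dg operads from the free dg operad to the operadic version of \<open>C\<close>,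
  which sits in degree 0 with zero differential.
\<close>

locale free_resolution =
  small_category C + dg_free_operad "obs C" F d
  for C :: "('o, 'm) category"
    and F :: "('o, 'g) coloured_basis"
    and d :: "(('o, 'g) word \<Rightarrow>\<^sub>0 'k::field) \<Rightarrow> (('o, 'g) word \<Rightarrow>\<^sub>0 'k)" +
  fixes \<pi> :: "(('o, 'g) word \<Rightarrow>\<^sub>0 'k) \<Rightarrow> ('m \<Rightarrow>\<^sub>0 'k)"
  assumes pi_linear: "klinear (free_operad (obs C) F) (kspan (mors C)) \<pi>"
    and pi_complex: "\<lbrakk>a \<in> obs C; b \<in> obs C; r \<in> free_complex (obs C) F b a i\<rbrakk>
       \<Longrightarrow> \<pi> r \<in> cat_complex C b a i"
    and pi_unit: "a \<in> obs C \<Longrightarrow> \<pi> (unit_elem a) = Poly_Mapping.single (ident C a) 1"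
    and pi_comp: "\<lbrakk>a \<in> obs C; b \<in> obs C; c \<in> obs C;
        r \<in> free_hom (obs C) F c b; s \<in> free_hom (obs C) F b a\<rbrakk>
       \<Longrightarrow> \<pi> (free_comp F r s) = cat_comp C (\<pi> r) (\<pi> s)"
    and pi_chain: "r \<in> free_operad (obs C) F \<Longrightarrow> \<pi> (d r) = 0"
    and pi_quism: "\<lbrakk>a \<in> obs C; b \<in> obs C\<rbrakk>
       \<Longrightarrow> homology_iso (free_complex (obs C) F b a) d (cat_complex C b a) (\<lambda>_. 0) \<pi>"

text \<open>
  The map \<open>\<iota>\<close> identifies \<open>M\<close> with the degree 0 generators. The set \<open>R\<close> of the second
  assumption is the set of degree 1 generators.
\<close>

definition degree0_assumption ::
  "('o, 'm) category \<Rightarrow> ('o, 'g) coloured_basis \<Rightarrow> 'm set \<Rightarrow> ('m \<Rightarrow> 'g) \<Rightarrow> bool" where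
  "degree0_assumption C F M \<iota> \<longleftrightarrow>
     M \<subseteq> mors C - ident C ` obs C \<and>
     bij_betw \<iota> M {g \<in> gens F. gdeg F g = 0} \<and>
     (\<forall>f\<in>M. gin F (\<iota> f) = src C f \<and> gout F (\<iota> f) = tgt C f)"

definition degree1_assumption ::
  "'o set \<Rightarrow> ('o, 'g) coloured_basis \<Rightarrow> ((('o, 'g) word \<Rightarrow>\<^sub>0 'k::field) \<Rightarrow> (('o, 'g) word \<Rightarrow>\<^sub>0 'k)) \<Rightarrow>
   'm set \<Rightarrow> ('m \<Rightarrow> 'g) \<Rightarrow> bool" where
  "degree1_assumption V F d M \<iota> \<longleftrightarrow>
     (\<forall>r \<in> {g \<in> gens F. gdeg F g = 1}.
        \<exists>r1\<in>words V F. \<exists>r2\<in>words V F. set (fst r1) \<subseteq> \<iota> ` M \<and> set (fst r2) \<subseteq> \<iota> ` M \<and>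
          d (gen_elem F r) = Poly_Mapping.single r1 1 - Poly_Mapping.single r2 1)"

section \<open>Tensor powers\<close>

text \<open>
  The \<open>n\<close>-th tensor power of the span of \<open>S\<close> is the span of the \<open>n\<close>-tuples over \<open>S\<close>, the tuple
  \<open>[w\<^sub>1, \<dots>, w\<^sub>n]\<close> being the basis tensor \<open>w\<^sub>1 \<otimes> \<dots> \<otimes> w\<^sub>n\<close>. Positions are counted from 0.
\<close>

definition tensor_power :: "nat \<Rightarrow> 'w set \<Rightarrow> ('w list \<Rightarrow>\<^sub>0 'k::field) set" where
  "tensor_power n S = kspan {ws. length ws = n \<and> set ws \<subseteq> S}"

fun tensor :: "('w \<Rightarrow>\<^sub>0 'k::field) list \<Rightarrow> ('w list \<Rightarrow>\<^sub>0 'k)" where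
  "tensor [] = Poly_Mapping.single [] 1"
| "tensor (r # rs) = bilin_ext (\<lambda>w ws. Poly_Mapping.single (w # ws) 1) r (tensor rs)"

definition tensor_deg ::
  "'o set \<Rightarrow> ('o, 'g) coloured_basis \<Rightarrow> nat \<Rightarrow> nat \<Rightarrow> (('o, 'g) word list \<Rightarrow>\<^sub>0 'k::field) set" where
  "tensor_deg V F n i =
     kspan {ws. length ws = n \<and> set ws \<subseteq> words V F \<and> sum_list (map (word_deg F) ws) = i}"

definition tensor_diff ::
  "('o, 'g) coloured_basis \<Rightarrow> ((('o, 'g) word \<Rightarrow>\<^sub>0 'k::field) \<Rightarrow> (('o, 'g) word \<Rightarrow>\<^sub>0 'k)) \<Rightarrow>
   (('o, 'g) word list \<Rightarrow>\<^sub>0 'k) \<Rightarrow> (('o, 'g) word list \<Rightarrow>\<^sub>0 'k)" where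
  "tensor_diff F d = lin_ext (\<lambda>ws. \<Sum>i<length ws.
     smul ((-1) ^ (\<Sum>j<i. word_deg F (ws ! j)))
       (tensor ((map (\<lambda>w. Poly_Mapping.single w 1) ws)[i := d (Poly_Mapping.single (ws ! i) 1)])))"

definition tensor_comp ::
  "('o, 'g) coloured_basis \<Rightarrow> nat \<Rightarrow> (('o, 'g) word list \<Rightarrow>\<^sub>0 'k::field) \<Rightarrow>
   (('o, 'g) word list \<Rightarrow>\<^sub>0 'k) \<Rightarrow> (('o, 'g) word list \<Rightarrow>\<^sub>0 'k)" where
  "tensor_comp F n = bilin_ext (\<lambda>us ws.
     if \<forall>i<n. word_in (us ! i) = word_out F (ws ! i)
     then Poly_Mapping.single (map2 word_comp us ws)
            ((-1) ^ (\<Sum>i<n. \<Sum>j<i. word_deg F (us ! i) * word_deg F (ws ! j)))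
     else 0)"

definition transpose_op ::
  "('o, 'g) coloured_basis \<Rightarrow> nat \<Rightarrow> nat \<Rightarrow>
   (('o, 'g) word list \<Rightarrow>\<^sub>0 'k::field) \<Rightarrow> (('o, 'g) word list \<Rightarrow>\<^sub>0 'k)" where
  "transpose_op F i j = lin_ext (\<lambda>ws.
     Poly_Mapping.single (ws[i := ws ! j, j := ws ! i])
       ((-1) ^ (word_deg F (ws ! i) * word_deg F (ws ! j) +
                (word_deg F (ws ! i) + word_deg F (ws ! j)) *
                (\<Sum>l\<in>{i<..<j}. word_deg F (ws ! l)))))"

text \<open>The operators by which the elements of \<open>\<Sigma>\<^sub>n\<close> act.\<close>

inductive_set sigma_ops ::
  "('o, 'g) coloured_basis \<Rightarrow> nat \<Rightarrow>
   ((('o, 'g) word list \<Rightarrow>\<^sub>0 'k::field) \<Rightarrow> (('o, 'g) word list \<Rightarrow>\<^sub>0 'k)) set"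
  for F :: "('o, 'g) coloured_basis" and n :: nat where
  "id \<in> sigma_ops F n"
| "\<lbrakk>\<sigma> \<in> sigma_ops F n; i < j; j < n\<rbrakk> \<Longrightarrow> transpose_op F i j \<circ> \<sigma> \<in> sigma_ops F n"

definition sigma_stable ::
  "('o, 'g) coloured_basis \<Rightarrow> nat \<Rightarrow> (('o, 'g) word list \<Rightarrow>\<^sub>0 'k::field) \<Rightarrow> bool" where
  "sigma_stable F n t \<longleftrightarrow> (\<forall>\<sigma>\<in>sigma_ops F n. \<sigma> t = t)"

end

theory Submission
  imports Defs Complex_Main "HOL-Library.Multiset"
begin

text \<open>
  A map compatible with composition is determined by its values on generators, which are chosen by
  recursion on the degree. On a generator \<open>g\<close> one needs an invariant \<open>x\<close> with
  \<open>\<partial>x = [[\<partial>g]]\<close>, the right-hand side being an invariant cycle by induction. In degree 1 it is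
  \<open>r\<^sub>1 \<otimes> \<dots> \<otimes> r\<^sub>1 - r\<^sub>2 \<otimes> \<dots> \<otimes> r\<^sub>2\<close>, the boundary of the telescoping sum of the tensors
  \<open>r\<^sub>2 \<otimes> \<dots> \<otimes> r\<^sub>2 \<otimes> g \<otimes> r\<^sub>1 \<otimes> \<dots> \<otimes> r\<^sub>1\<close>. In degree at least 2 it is a boundary because a
  contraction of the resolution onto its homology in degree 0 induces one of the tensor power,
  which is therefore acyclic in positive degrees. In characteristic 0 a solution can be averaged
  into an invariant one.
\<close>

section \<open>Linear and bilinear maps on spans\<close>

text \<open>For a generator g of degree 1 the element [[\<partial>g]] lies in degree 0, where
  acyclicity says nothing. Since sending a word to its n-th tensor power does not come from a linear
  formula, that \<partial>g bounds does not formally make [[\<partial>g]] bound. Assumption (ii)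
  overcomes this: the image of a difference of two words of degree 0 is a difference of two powers,
  joined by an explicit path. That the extension by composition stays invariant and commutes with
  the differentials rests on sign statements about factorwise composition: it is associative, obeys
  the Leibniz rule and commutes with transpositions. Each is proved by splitting off the first
  tensor factor. This replaces the long exponents of the definitions by rules for r \<otimes> t
  whose sign is a single product of degrees, and it moves an adjacent transposition to the front,
  where only two factors have to be examined.\<close>

lemma lookup_smul [simp]: "Poly_Mapping.lookup (smul c p) x = c * Poly_Mapping.lookup p x"
  by (auto simp: smul_def map.rep_eq when_def)

text \<open>Connects \<open>smul\<close> with the library of abstract vector spaces. Its main
  service is the linear right inverse of a map on a subspace, from which \<open>contraction\<close>
  is built.\<close>

interpretation pm: vector_space "smul :: 'k::field \<Rightarrow> ('a \<Rightarrow>\<^sub>0 'k) \<Rightarrow> ('a \<Rightarrow>\<^sub>0 'k)"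
  by unfold_locales (auto intro!: poly_mapping_eqI simp: lookup_add algebra_simps)

interpretation pm: vector_space_pair
  "smul :: 'k::field \<Rightarrow> ('a \<Rightarrow>\<^sub>0 'k) \<Rightarrow> ('a \<Rightarrow>\<^sub>0 'k)" "smul :: 'k::field \<Rightarrow> ('b \<Rightarrow>\<^sub>0 'k) \<Rightarrow> ('b \<Rightarrow>\<^sub>0 'k)"
  by unfold_locales

abbreviation bas :: "'a \<Rightarrow> ('a \<Rightarrow>\<^sub>0 'k::zero_neq_one)" where
  "bas x \<equiv> Poly_Mapping.single x 1"

text \<open>Linearity on the whole space, so that composites have no side conditions. Spans enter
  only when maps are compared or their values located, by \<open>lin_eq_on\<close>,
  \<open>lin_into\<close> and their bilinear versions.\<close>

abbreviation lin :: "(('a \<Rightarrow>\<^sub>0 'k::field) \<Rightarrow> ('b \<Rightarrow>\<^sub>0 'k)) \<Rightarrow> bool" where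
  "lin \<equiv> klinear UNIV UNIV"

definition bilin :: "(('a \<Rightarrow>\<^sub>0 'k::field) \<Rightarrow> ('b \<Rightarrow>\<^sub>0 'k) \<Rightarrow> ('c \<Rightarrow>\<^sub>0 'k)) \<Rightarrow> bool" where
  "bilin B \<longleftrightarrow> (\<forall>x. lin (B x)) \<and> (\<forall>y. lin (\<lambda>x. B x y))"

lemma linI:
  assumes "\<And>x y. f (x + y) = f x + f y" "\<And>c x. f (smul c x) = smul c (f x)"
  shows "lin f"
  using assms by (simp add: klinear_def)

lemma lin_add: "lin f \<Longrightarrow> f (x + y) = f x + f y"
  and lin_smul: "lin f \<Longrightarrow> f (smul c x) = smul c (f x)"
  by (simp_all add: klinear_def)

lemma lin_iff_linear: "lin f \<longleftrightarrow> Vector_Spaces.linear smul smul f"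
proof
  show "Vector_Spaces.linear smul smul f" if "lin f"
    using that by unfold_locales (simp_all add: lin_add lin_smul)
  show "lin f" if "Vector_Spaces.linear smul smul f"
    using that by (intro linI) (simp_all add: pm.linear_add pm.linear_scale)
qed

lemma lin_0: "lin f \<Longrightarrow> f 0 = 0"
  and lin_diff: "lin f \<Longrightarrow> f (x - y) = f x - f y"
  and lin_uminus: "lin f \<Longrightarrow> f (- x) = - f x"
  and lin_sum: "lin f \<Longrightarrow> f (sum g S) = (\<Sum>a\<in>S. f (g a))"
  by (simp_all add: lin_iff_linear pm.linear_0 pm.linear_diff pm.linear_neg pm.linear_sum)

lemma lin_id: "lin (\<lambda>x. x)"
  and lin_zero: "lin (\<lambda>x. 0)"
  by (auto intro!: linI)

lemma lin_comp: "lin f \<Longrightarrow> lin g \<Longrightarrow> lin (\<lambda>x. f (g x))"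
  by (auto intro!: linI simp: lin_add lin_smul)

lemma lin_plus: "lin f \<Longrightarrow> lin g \<Longrightarrow> lin (\<lambda>x. f x + g x)"
  and lin_minus: "lin f \<Longrightarrow> lin g \<Longrightarrow> lin (\<lambda>x. f x - g x)"
  and lin_scaled: "lin f \<Longrightarrow> lin (\<lambda>x. smul c (f x))"
  by (auto intro!: linI simp: lin_add lin_smul algebra_simps)

lemma bilinI:
  assumes "\<And>x. lin (B x)" "\<And>y. lin (\<lambda>x. B x y)"
  shows "bilin B"
  using assms by (simp add: bilin_def)

lemma bilin_lin2: "bilin B \<Longrightarrow> lin f \<Longrightarrow> lin (\<lambda>x. B y (f x))"
  unfolding bilin_def using lin_comp[of "B y" f] by auto

lemma bilin_lin1: "bilin B \<Longrightarrow> lin f \<Longrightarrow> lin (\<lambda>x. B (f x) y)"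
  unfolding bilin_def using lin_comp[of "\<lambda>x. B x y" f] by auto

lemma bilin_simps:
  assumes "bilin B"
  shows "B (x + y) z = B x z + B y z" "B (x - y) z = B x z - B y z" "B (- x) z = - B x z"
    "B 0 z = 0" "B (smul c x) z = smul c (B x z)"
    "B x (z + w) = B x z + B x w" "B x (z - w) = B x z - B x w" "B x (- z) = - B x z"
    "B x 0 = 0" "B x (smul c z) = smul c (B x z)"
  using assms unfolding bilin_def
  using lin_add[of "\<lambda>x. B x z"] lin_diff[of "\<lambda>x. B x z"] lin_uminus[of "\<lambda>x. B x z"]
    lin_0[of "\<lambda>x. B x z"] lin_smul[of "\<lambda>x. B x z"]
  by (auto simp: lin_add lin_diff lin_uminus lin_0 lin_smul)

lemma sum_bas: "(\<Sum>x\<in>Poly_Mapping.keys p. smul (Poly_Mapping.lookup p x) (bas x)) = p"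
  by (rule poly_mapping_eqI)
    (auto simp: lookup_sum lookup_single when_def in_keys_iff if_distrib cong: if_cong)

lemma kspan_bas [simp]: "bas x \<in> kspan S \<longleftrightarrow> (x \<in> S)"
  by (auto simp: kspan_def)

lemma kspan_0 [simp]: "0 \<in> kspan S"
  by (simp add: kspan_def)

lemma kspan_smul [intro, simp]: "p \<in> kspan S \<Longrightarrow> smul c p \<in> kspan S"
  by (auto simp: kspan_def in_keys_iff subset_iff)

lemma kspan_add [intro]: "p \<in> kspan S \<Longrightarrow> q \<in> kspan S \<Longrightarrow> p + q \<in> kspan S"
  by (auto simp: kspan_def in_keys_iff subset_iff lookup_add) (metis add.right_neutral)

lemma kspan_uminus [intro]: "(p :: 'a \<Rightarrow>\<^sub>0 'k::field) \<in> kspan S \<Longrightarrow> - p \<in> kspan S"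
  by (auto simp: kspan_def in_keys_iff subset_iff)

lemma kspan_diff [intro]:
  fixes p q :: "'a \<Rightarrow>\<^sub>0 'k::field"
  shows "p \<in> kspan S \<Longrightarrow> q \<in> kspan S \<Longrightarrow> p - q \<in> kspan S"
  using kspan_add[of p S "- q"] by auto

lemma kspan_sum [intro]: "(\<And>x. x \<in> T \<Longrightarrow> f x \<in> kspan S) \<Longrightarrow> sum f T \<in> kspan S"
  by (induction T rule: infinite_finite_induct) auto

lemma kspan_subspace: "pm.subspace (kspan S)"
  by (auto intro!: pm.subspaceI)

lemma kspan_mono: "S \<subseteq> T \<Longrightarrow> kspan S \<subseteq> kspan T"
  by (auto simp: kspan_def)

lemma kspan_Int: "kspan S \<inter> kspan T = kspan (S \<inter> T)"
  by (auto simp: kspan_def)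

lemma kspan_induct [consumes 1, case_names zero basis add smul]:
  assumes "p \<in> kspan S" "P 0" "\<And>x. x \<in> S \<Longrightarrow> P (bas x)"
    "\<And>x y. P x \<Longrightarrow> P y \<Longrightarrow> P (x + y)" "\<And>c x. P x \<Longrightarrow> P (smul c x)"
  shows "P p"
proof -
  have *: "P (\<Sum>x\<in>T. smul (Poly_Mapping.lookup p x) (bas x))" if "finite T" "T \<subseteq> S" for T
    using that by (induction T rule: finite_induct) (auto intro: assms)
  show ?thesis
    using *[of "Poly_Mapping.keys p"] assms(1) by (simp add: sum_bas kspan_def)
qed

lemma lin_eq_on:
  assumes "lin f" "lin g" "\<And>x. x \<in> S \<Longrightarrow> f (bas x) = g (bas x)" "p \<in> kspan S"
  shows "f p = g p"
  using assms(4) by (induction rule: kspan_induct) (simp_all add: assms lin_0 lin_add lin_smul)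

lemma lin_into:
  assumes "lin f" "\<And>x. x \<in> S \<Longrightarrow> f (bas x) \<in> kspan T" "p \<in> kspan S"
  shows "f p \<in> kspan T"
  using assms(3) by (induction rule: kspan_induct) (auto simp: assms lin_0 lin_add lin_smul)

lemma bilin_eq_on:
  assumes "bilin B" "bilin B'"
    "\<And>x y. x \<in> S \<Longrightarrow> y \<in> T \<Longrightarrow> B (bas x) (bas y) = B' (bas x) (bas y)"
    "p \<in> kspan S" "q \<in> kspan T"
  shows "B p q = B' p q"
proof (rule lin_eq_on[of "\<lambda>p. B p q" "\<lambda>p. B' p q", OF _ _ _ assms(4)])
  show "B (bas x) q = B' (bas x) q" if "x \<in> S" for x
    by (rule lin_eq_on[of _ _ T]) (use that assms in \<open>auto simp: bilin_def\<close>)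
qed (use assms in \<open>auto simp: bilin_def\<close>)

lemma bilin_into:
  assumes "bilin B" "\<And>x y. x \<in> S \<Longrightarrow> y \<in> T \<Longrightarrow> B (bas x) (bas y) \<in> kspan U"
    "p \<in> kspan S" "q \<in> kspan T"
  shows "B p q \<in> kspan U"
proof (rule lin_into[of "\<lambda>p. B p q", OF _ _ assms(3)])
  show "B (bas x) q \<in> kspan U" if "x \<in> S" for x
    by (rule lin_into[of _ T]) (use that assms in \<open>auto simp: bilin_def\<close>)
qed (use assms in \<open>auto simp: bilin_def\<close>)

lemma lin_ext_superset:
  assumes "finite S" "Poly_Mapping.keys p \<subseteq> S"
  shows "lin_ext f p = (\<Sum>x\<in>S. smul (Poly_Mapping.lookup p x) (f x))"
  unfolding lin_ext_def
  by (rule sum.mono_neutral_left) (use assms in \<open>auto simp: in_keys_iff\<close>)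

lemma lin_lin_ext: "lin (lin_ext f)"
proof (rule linI)
  fix p q :: "'a \<Rightarrow>\<^sub>0 'b" and c
  let ?S = "Poly_Mapping.keys p \<union> Poly_Mapping.keys q"
  show "lin_ext f (p + q) = lin_ext f p + lin_ext f q"
    using keys_add[of p q]
    by (simp add: lin_ext_superset[of ?S] lookup_add pm.scale_left_distrib sum.distrib)
  have "Poly_Mapping.keys (smul c p) \<subseteq> Poly_Mapping.keys p"
    by (auto simp: in_keys_iff)
  then show "lin_ext f (smul c p) = smul c (lin_ext f p)"
    by (simp add: lin_ext_superset[of "Poly_Mapping.keys p"] pm.scale_sum_right)
qed

lemma lin_ext_bas [simp]: "lin_ext f (bas x) = f x"
  by (simp add: lin_ext_def)

lemma lin_lin_ext_param:
  assumes "\<And>x. lin (\<lambda>q. f q x)"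
  shows "lin (\<lambda>q. lin_ext (f q) p)"
proof (rule linI)
  fix x y c
  have "f (x + y) z = f x z + f y z" "f (smul c x) z = smul c (f x z)" for z
    using lin_add[OF assms[of z]] lin_smul[OF assms[of z]] by auto
  then show "lin_ext (f (x + y)) p = lin_ext (f x) p + lin_ext (f y) p"
    and "lin_ext (f (smul c x)) p = smul c (lin_ext (f x) p)"
    by (simp_all add: lin_ext_def pm.scale_right_distrib sum.distrib pm.scale_sum_right mult.commute)
qed

lemma bilin_bilin_ext: "bilin (bilin_ext f)"
  unfolding bilin_ext_def by (intro bilinI lin_lin_ext_param lin_lin_ext)

lemma bilin_ext_bas [simp]: "bilin_ext f (bas x) (bas y) = f x y"
  by (simp add: bilin_ext_def)

lemma single_smul: "Poly_Mapping.single x c = smul c (bas x)"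
  by (rule poly_mapping_eqI) (simp add: lookup_single when_def)

section \<open>The tensor operations on elementary tensors\<close>

text \<open>The recursion step of \<open>tensor\<close>, but with an arbitrary tensor as second
  argument. The rules for \<open>r \<otimes> t\<close> below turn statements on n factors into
  inductions on n.\<close>

definition ten :: "('w \<Rightarrow>\<^sub>0 'k::field) \<Rightarrow> ('w list \<Rightarrow>\<^sub>0 'k) \<Rightarrow> ('w list \<Rightarrow>\<^sub>0 'k)" (infixr "\<otimes>" 75) where
  "r \<otimes> t = bilin_ext (\<lambda>w ws. bas (w # ws)) r t"

lemma bilin_ten: "bilin (\<otimes>)"
  unfolding ten_def by (rule bilin_bilin_ext)

lemma bilin_free_comp: "bilin (free_comp F)"
  unfolding free_comp_def by (rule bilin_bilin_ext)

lemma bilin_tensor_comp: "bilin (tensor_comp F n)"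
  unfolding tensor_comp_def by (rule bilin_bilin_ext)

lemma lin_tensor_diff: "lin (tensor_diff F d)"
  unfolding tensor_diff_def by (rule lin_lin_ext)

lemma lin_transpose_op: "lin (transpose_op F i j)"
  unfolding transpose_op_def by (rule lin_lin_ext)

lemmas linear_simps =
  bilin_simps[OF bilin_ten] bilin_simps[OF bilin_free_comp] bilin_simps[OF bilin_tensor_comp]
  lin_0[OF lin_tensor_diff] lin_add[OF lin_tensor_diff] lin_diff[OF lin_tensor_diff]
  lin_uminus[OF lin_tensor_diff] lin_smul[OF lin_tensor_diff]
  lin_0[OF lin_transpose_op] lin_add[OF lin_transpose_op] lin_diff[OF lin_transpose_op]
  lin_uminus[OF lin_transpose_op] lin_smul[OF lin_transpose_op]

lemma ten_bas [simp]: "bas w \<otimes> bas ws = bas (w # ws)"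
  by (simp add: ten_def)

lemma tensor_Cons: "tensor (r # rs) = r \<otimes> tensor rs"
  by (simp add: ten_def)

lemma tensor_map_bas: "tensor (map bas ws) = bas ws"
  by (induction ws) (simp_all add: tensor_Cons del: tensor.simps(2))

abbreviation words_deg :: "('o, 'g) coloured_basis \<Rightarrow> ('o, 'g) word list \<Rightarrow> nat" where
  "words_deg F ws \<equiv> sum_list (map (word_deg F) ws)"

lemma tensor_diff_Nil [simp]: "tensor_diff F d (bas []) = 0"
  by (simp add: tensor_diff_def)

lemma ten_sum_right: "r \<otimes> sum f S = (\<Sum>x\<in>S. r \<otimes> f x)"
  using lin_sum[of "(\<otimes>) r" f S] bilin_ten unfolding bilin_def by blast

lemma tensor_diff_Cons:
  "tensor_diff F d (bas (w # ws)) =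
     d (bas w) \<otimes> bas ws + smul ((-1) ^ word_deg F w) (bas w \<otimes> tensor_diff F d (bas ws))"
proof -
  have *: "(\<Sum>j<Suc i. word_deg F ((w # ws) ! j)) = word_deg F w + (\<Sum>j<i. word_deg F (ws ! j))" for i
    by (simp only: sum.lessThan_Suc_shift nth_Cons_0 nth_Cons_Suc o_def)
  show ?thesis
    by (simp add: tensor_diff_def sum.lessThan_Suc_shift * tensor_Cons tensor_map_bas ten_sum_right
        pm.scale_sum_right power_add linear_simps del: tensor.simps(2) sum.lessThan_Suc)
qed

text \<open>The degree of \<open>r\<close> is the only one in the sign: it is what the differential
  passes on its way to \<open>t\<close>.\<close>

lemma tensor_diff_ten:
  assumes "lin d" "r \<in> kspan {w. word_deg F w = i}"
  shows "tensor_diff F d (r \<otimes> t) = d r \<otimes> t + smul ((-1) ^ i) (r \<otimes> tensor_diff F d t)"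
proof -
  have "bilin (\<lambda>r t. tensor_diff F d (r \<otimes> t))"
    by (intro bilinI lin_comp[OF lin_tensor_diff]) (use bilin_ten in \<open>auto simp: bilin_def\<close>)
  moreover have "bilin (\<lambda>r t. d r \<otimes> t + smul ((-1) ^ i) (r \<otimes> tensor_diff F d t))"
    by (intro bilinI lin_plus lin_scaled bilin_lin1[OF bilin_ten] bilin_lin2[OF bilin_ten]
        lin_tensor_diff lin_id assms)
  ultimately show ?thesis
    by (rule bilin_eq_on[OF _ _ _ assms(2), of _ _ UNIV t])
      (auto simp: tensor_diff_Cons kspan_def)
qed

lemma free_comp_bas:
  "free_comp F (bas u) (bas w) = (if word_in u = word_out F w then bas (word_comp u w) else 0)"
  by (simp add: free_comp_def)

text \<open>In the double sum of the definition the row i = 0 is empty, and the column j = 0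
  consists of the crossings of \<open>w\<close> with the factors of \<open>us\<close>.\<close>

lemma tensor_comp_Cons:
  assumes "length us = n"
  shows "tensor_comp F (Suc n) (bas (u # us)) (bas (w # ws)) =
     smul ((-1) ^ (words_deg F us * word_deg F w))
       (free_comp F (bas u) (bas w) \<otimes> tensor_comp F n (bas us) (bas ws))"
proof -
  let ?f = "\<lambda>us ws i. \<Sum>j<i. word_deg F (us ! i) * word_deg F (ws ! j)"
  have "(\<Sum>i<Suc n. ?f (u # us) (w # ws) i) = (\<Sum>i<n. ?f (u # us) (w # ws) (Suc i))"
    by (simp add: sum.lessThan_Suc_shift del: sum.lessThan_Suc)
  also have "\<dots> = (\<Sum>i<n. word_deg F (us ! i) * word_deg F w + ?f us ws i)"
    by (rule sum.cong) (simp_all only: sum.lessThan_Suc_shift nth_Cons_0 nth_Cons_Suc o_def)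
  also have "\<dots> = words_deg F us * word_deg F w + (\<Sum>i<n. ?f us ws i)"
    using assms by (simp add: sum.distrib sum_list_sum_nth sum_distrib_right atLeast0LessThan)
  finally have *: "(\<Sum>i<Suc n. ?f (u # us) (w # ws) i) =
    words_deg F us * word_deg F w + (\<Sum>i<n. ?f us ws i)" .
  have **: "(\<forall>i<Suc n. word_in ((u # us) ! i) = word_out F ((w # ws) ! i)) \<longleftrightarrow>
    word_in u = word_out F w \<and> (\<forall>i<n. word_in (us ! i) = word_out F (ws ! i))"
    by (auto simp: less_Suc_eq_0_disj)
  show ?thesis
    unfolding tensor_comp_def free_comp_bas bilin_ext_bas * **
    by (auto simp: single_smul[of _ "(-1) ^ _"] single_smul[of _ "_ * _"] linear_simps power_add)
qed

lemma tensor_comp_Nil [simp]: "tensor_comp F 0 (bas []) (bas []) = bas []"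
  by (simp add: tensor_comp_def)

text \<open>Homogeneity is asked of the two inner arguments \<open>t\<close> and \<open>s\<close>,
  which are the ones that change places. The formula is extended from basis elements in one argument
  at a time.\<close>

lemma tensor_comp_ten:
  assumes "t \<in> kspan {us. length us = n \<and> words_deg F us = i}" "s \<in> kspan {w. word_deg F w = j}"
  shows "tensor_comp F (Suc n) (r \<otimes> t) (s \<otimes> t') =
    smul ((-1) ^ (i * j)) (free_comp F r s \<otimes> tensor_comp F n t t')"
proof -
  have bas: "tensor_comp F (Suc n) (bas u \<otimes> bas us) (bas w \<otimes> bas ws) =
    smul ((-1) ^ (i * j)) (free_comp F (bas u) (bas w) \<otimes> tensor_comp F n (bas us) (bas ws))"
    if "length us = n" "words_deg F us = i" "word_deg F w = j" for u us w ws
    using that by (simp add: tensor_comp_Cons)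
  have 1: "tensor_comp F (Suc n) (bas u \<otimes> t) (bas w \<otimes> bas ws) =
    smul ((-1) ^ (i * j)) (free_comp F (bas u) (bas w) \<otimes> tensor_comp F n t (bas ws))"
    if "word_deg F w = j" for u w ws
    using assms(1) by (induction rule: kspan_induct)
      (use that in \<open>simp_all add: bas linear_simps algebra_simps del: ten_bas\<close>)
  have 2: "tensor_comp F (Suc n) (bas u \<otimes> t) (s \<otimes> bas ws) =
    smul ((-1) ^ (i * j)) (free_comp F (bas u) s \<otimes> tensor_comp F n t (bas ws))" for u ws
    using assms(2) by (induction rule: kspan_induct)
      (simp_all add: 1 linear_simps algebra_simps del: ten_bas)
  have "r \<in> kspan UNIV" "t' \<in> kspan UNIV"
    by (auto simp: kspan_def)
  from this(1) have 3: "tensor_comp F (Suc n) (r \<otimes> t) (s \<otimes> bas ws) =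
    smul ((-1) ^ (i * j)) (free_comp F r s \<otimes> tensor_comp F n t (bas ws))" for ws
    by (induction rule: kspan_induct) (simp_all add: 2 linear_simps algebra_simps)
  show ?thesis
    using \<open>t' \<in> kspan UNIV\<close>
    by (induction rule: kspan_induct) (simp_all add: 3 linear_simps algebra_simps)
qed

text \<open>The sign of a transposition involves only the exchanged factors and those between them,
  so a factor in front is inert.\<close>

lemma transpose_op_Suc_ten:
  "transpose_op F (Suc i) (Suc j) (r \<otimes> t) = r \<otimes> transpose_op F i j t"
proof -
  have *: "(\<Sum>l\<in>{Suc i<..<Suc j}. f l) = (\<Sum>l\<in>{i<..<j}. f (Suc l))" for f :: "nat \<Rightarrow> nat"
    by (rule sum.reindex_bij_witness[of _ Suc "\<lambda>l. l - 1"]) auto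
  have bas: "transpose_op F (Suc i) (Suc j) (bas w \<otimes> bas ws) = bas w \<otimes> transpose_op F i j (bas ws)" for w ws
    unfolding ten_bas transpose_op_def lin_ext_bas
    by (simp add: * single_smul[of _ "(-1) ^ _"] linear_simps)
  have "bilin (\<lambda>r t. transpose_op F (Suc i) (Suc j) (r \<otimes> t))"
    "bilin (\<lambda>r t. r \<otimes> transpose_op F i j t)"
    by (auto intro!: bilinI lin_comp[OF lin_transpose_op] bilin_lin1[OF bilin_ten]
        bilin_lin2[OF bilin_ten] lin_id lin_transpose_op)
  then show ?thesis
    by (rule bilin_eq_on[where S = UNIV and T = UNIV]) (use bas in \<open>auto simp: kspan_def\<close>)
qed

lemma transpose_op_0_ten:
  assumes "r \<in> kspan {w. word_deg F w = i}" "s \<in> kspan {w. word_deg F w = j}"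
  shows "transpose_op F 0 (Suc 0) (r \<otimes> s \<otimes> t) = smul ((-1) ^ (i * j)) (s \<otimes> r \<otimes> t)"
proof -
  have bas: "transpose_op F 0 (Suc 0) (bas u \<otimes> bas w \<otimes> bas ws) =
    smul ((-1) ^ (i * j)) (bas w \<otimes> bas u \<otimes> bas ws)"
    if "word_deg F u = i" "word_deg F w = j" for u w ws
  proof -
    have "{0<..<Suc 0} = {}" by auto
    with that show ?thesis
      by (simp add: transpose_op_def single_smul[of _ "(-1) ^ _"])
  qed
  have 1: "transpose_op F 0 (Suc 0) (r \<otimes> bas w \<otimes> bas ws) =
    smul ((-1) ^ (i * j)) (bas w \<otimes> r \<otimes> bas ws)"
    if "word_deg F w = j" for w ws
    using assms(1) by (induction rule: kspan_induct)
      (use that in \<open>simp_all add: bas linear_simps algebra_simps del: ten_bas\<close>)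
  have 2: "transpose_op F 0 (Suc 0) (r \<otimes> s \<otimes> bas ws) =
    smul ((-1) ^ (i * j)) (s \<otimes> r \<otimes> bas ws)" for ws
    using assms(2) by (induction rule: kspan_induct)
      (simp_all add: 1 linear_simps algebra_simps del: ten_bas)
  have "t \<in> kspan UNIV"
    by (auto simp: kspan_def)
  then show ?thesis
    by (induction rule: kspan_induct) (simp_all add: 2 linear_simps algebra_simps)
qed

lemma transpose_op_bas:
  "transpose_op F i j (bas ws) =
    smul ((-1) ^ (word_deg F (ws ! i) * word_deg F (ws ! j) +
            (word_deg F (ws ! i) + word_deg F (ws ! j)) * (\<Sum>l\<in>{i<..<j}. word_deg F (ws ! l))))
      (bas (ws[i := ws ! j, j := ws ! i]))"
  unfolding transpose_op_def lin_ext_bas by (rule single_smul)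

text \<open>Let A, B, C be the degrees in positions i, j, j+1 and S the sum of those strictly
  between i and j. The exponents of the three transpositions on the right, BC, AC + (A+C)S and AB,
  add up to AC + (A+C)(S+B), the exponent on the left.\<close>

lemma transpose_op_Suc_right:
  assumes "i < j" "Suc j < length ws"
  shows "transpose_op F i (Suc j) (bas ws) =
    transpose_op F j (Suc j) (transpose_op F i j (transpose_op F j (Suc j) (bas ws)))"
proof -
  have *: "{j<..<Suc j} = {}" "{i<..<Suc j} = insert j {i<..<j}"
    using assms by auto
  let ?us = "ws[j := ws ! Suc j, Suc j := ws ! j]"
  have "?us[i := ?us ! j, j := ?us ! i, j := ?us[i := ?us ! j, j := ?us ! i] ! Suc j,
      Suc j := ?us[i := ?us ! j, j := ?us ! i] ! j] = ws[i := ws ! Suc j, Suc j := ws ! i]"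
    using assms by (intro nth_equalityI) (auto simp: nth_list_update)
  moreover have "(\<Sum>l\<in>{i<..<j}. word_deg F (?us ! l)) = (\<Sum>l\<in>{i<..<j}. word_deg F (ws ! l))"
    by (rule sum.cong) auto
  ultimately show ?thesis
    using assms by (simp add: transpose_op_bas linear_simps * nth_list_update)
      (auto simp: minus_one_power_iff)
qed

text \<open>The exponent is symmetric in the two exchanged degrees and the factors in between stay
  in place, so the same sign occurs twice.\<close>

lemma transpose_op_involutive:
  assumes "i < j" "t \<in> kspan {ws. j < length ws}"
  shows "transpose_op F i j (transpose_op F i j t) = t"
proof (rule lin_eq_on[OF lin_comp[OF lin_transpose_op lin_transpose_op] lin_id _ assms(2)])
  fix ws :: "('b, 'a) word list" assume "ws \<in> {ws. j < length ws}"
  then have len: "j < length ws" by simp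
  let ?us = "ws[i := ws ! j, j := ws ! i]"
  have "?us[i := ?us ! j, j := ?us ! i] = ws"
    using assms len by (intro nth_equalityI) (auto simp: nth_list_update)
  moreover have "(\<Sum>l\<in>{i<..<j}. word_deg F (?us ! l)) = (\<Sum>l\<in>{i<..<j}. word_deg F (ws ! l))"
    by (rule sum.cong) auto
  moreover have "?us ! i = ws ! j" "?us ! j = ws ! i"
    using assms len by (auto simp: nth_list_update)
  ultimately show "transpose_op F i j (transpose_op F i j (bas ws)) = bas ws"
    by (simp add: transpose_op_bas linear_simps mult.commute add.commute flip: power_add)
qed

text \<open>Since \<open>T\<^bsub>i,j+1\<^esub> = T\<^bsub>j,j+1\<^esub> T\<^bsub>i,j\<^esub> T\<^bsub>j,j+1\<^esub>\<close>, it suffices to treat adjacent transpositions.\<close>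

lemma transpose_op_induct [consumes 2, case_names adjacent comp cong]:
  assumes "i < j" "j < n"
    and adj: "\<And>k. Suc k < n \<Longrightarrow> P (transpose_op F k (Suc k))"
    and comp: "\<And>f g. P f \<Longrightarrow> P g \<Longrightarrow> P (f \<circ> g)"
    and cong: "\<And>f g. P f \<Longrightarrow> lin f \<Longrightarrow> lin g \<Longrightarrow>
      (\<And>ws. length ws = n \<Longrightarrow> f (bas ws) = g (bas ws)) \<Longrightarrow> P g"
  shows "P (transpose_op F i j)"
  using assms(1,2)
proof (induction j)
  case (Suc j)
  show ?case
  proof (cases "i = j")
    case True
    then show ?thesis using adj Suc by simp
  next
    case False
    let ?f = "transpose_op F j (Suc j) \<circ> (transpose_op F i j \<circ> transpose_op F j (Suc j))"
    have "lin ?f"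
      using lin_comp[OF lin_transpose_op lin_comp[OF lin_transpose_op lin_transpose_op]]
      by (simp add: o_def)
    moreover have "P ?f"
      using Suc False by (intro comp adj) auto
    \<comment> \<open>The threefold composite is known to agree with the transposition only on
      tensors with n factors; \<open>cong\<close> transfers \<open>P\<close> across such partial
      agreement.\<close>
    ultimately show ?thesis
      by (intro cong[of ?f "transpose_op F i (Suc j)"]) (use Suc False in \<open>auto simp: transpose_op_Suc_right lin_transpose_op\<close>)
  qed
qed simp

section \<open>Homogeneous components\<close>

definition homog :: "'o set \<Rightarrow> ('o, 'g) coloured_basis \<Rightarrow> 'o \<Rightarrow> 'o \<Rightarrow> nat \<Rightarrow> ('o, 'g) word set" where
  "homog V F b a i = {w \<in> hom_words V F b a. word_deg F w = i}"

text \<open>The place where [[r]]_n must lie for homogeneous r: (C2) prescribes the colours of every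
  single factor, (C3) only the total degree.\<close>

definition thomog :: "'o set \<Rightarrow> ('o, 'g) coloured_basis \<Rightarrow> nat \<Rightarrow> 'o \<Rightarrow> 'o \<Rightarrow> nat \<Rightarrow> ('o, 'g) word list set" where
  "thomog V F n b a i = {ws. length ws = n \<and> set ws \<subseteq> hom_words V F b a \<and> words_deg F ws = i}"

lemma thomog_0: "thomog V F 0 b a i = (if i = 0 then {[]} else {})"
  by (auto simp: thomog_def)

lemma thomog_Cons:
  "w # ws \<in> thomog V F (Suc n) b a k \<longleftrightarrow>
    (\<exists>i j. k = i + j \<and> w \<in> homog V F b a i \<and> ws \<in> thomog V F n b a j)"
  by (auto simp: thomog_def homog_def)

lemma thomog_SucE:
  assumes "ws \<in> thomog V F (Suc n) b a k"
  obtains w vs i j where "ws = w # vs" "k = i + j" "w \<in> homog V F b a i" "vs \<in> thomog V F n b a j"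
proof (cases ws)
  case (Cons w vs)
  then show ?thesis
    using assms that unfolding Cons thomog_Cons by blast
qed (use assms in \<open>simp add: thomog_def\<close>)

lemma homogD: "w \<in> homog V F b a i \<Longrightarrow> word_deg F w = i"
  "w \<in> homog V F b a i \<Longrightarrow> word_in w = a" "w \<in> homog V F b a i \<Longrightarrow> word_out F w = b"
  "w \<in> homog V F b a i \<Longrightarrow> w \<in> words V F"
  by (auto simp: homog_def hom_words_def)

lemma kspan_homog_deg: "r \<in> kspan (homog V F b a i) \<Longrightarrow> r \<in> kspan {w. word_deg F w = i}"
  by (auto simp: kspan_def homog_def)

lemma kspan_thomog_deg:
  "t \<in> kspan (thomog V F n b a i) \<Longrightarrow> t \<in> kspan {ws. length ws = n \<and> words_deg F ws = i}"
  by (auto simp: kspan_def thomog_def)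

lemma ten_in_thomog:
  assumes "r \<in> kspan (homog V F b a i)" "t \<in> kspan (thomog V F n b a j)"
  shows "r \<otimes> t \<in> kspan (thomog V F (Suc n) b a (i + j))"
  by (rule bilin_into[OF bilin_ten _ assms]) (auto simp: thomog_Cons)

section \<open>Composition of words and of homogeneous tensors\<close>

lemma word_comp_out:
  "word_in u = word_out F w \<Longrightarrow> word_out F (word_comp u w) = word_out F u"
  by (cases u; cases w; cases "fst u") auto

lemma word_comp_in [simp]: "word_in (word_comp u w) = word_in w"
  by (cases u; cases w) auto

lemma word_comp_deg [simp]: "word_deg F (word_comp u w) = word_deg F u + word_deg F w"
  by (cases u; cases w) auto

lemma word_comp_is_word:
  "is_word V F u \<Longrightarrow> is_word V F w \<Longrightarrow> word_in u = word_out F w \<Longrightarrow> is_word V F (word_comp u w)"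
proof (induction V F u rule: is_word.induct)
  case (2 V F g gs a)
  then show ?case
    using word_comp_out[of "(gs, a)" F w] by (cases w) auto
qed (cases w, auto)

lemma word_comp_assoc: "word_comp (word_comp u v) w = word_comp u (word_comp v w)"
  by (cases u; cases v; cases w) auto

lemma word_comp_homog:
  "u \<in> homog V F c b i \<Longrightarrow> w \<in> homog V F b a j \<Longrightarrow> word_comp u w \<in> homog V F c a (i + j)"
  by (auto simp: homog_def hom_words_def words_def word_comp_is_word word_comp_out)

lemma free_comp_in_homog:
  assumes "r \<in> kspan (homog V F c b i)" "s \<in> kspan (homog V F b a j)"
  shows "free_comp F r s \<in> kspan (homog V F c a (i + j))"
  by (rule bilin_into[OF bilin_free_comp _ assms])
    (auto simp: free_comp_bas word_comp_homog homogD)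

lemma tensor_comp_in_thomog:
  fixes x :: "('o, 'g) word list \<Rightarrow>\<^sub>0 'k::field"
  assumes "x \<in> kspan (thomog V F n c b i)" "y \<in> kspan (thomog V F n b a j)"
  shows "tensor_comp F n x y \<in> kspan (thomog V F n c a (i + j))"
proof (rule bilin_into[OF bilin_tensor_comp _ assms])
  fix us ws assume "us \<in> thomog V F n c b i" "ws \<in> thomog V F n b a j"
  then show "tensor_comp F n (bas us) (bas ws :: _ \<Rightarrow>\<^sub>0 'k) \<in> kspan (thomog V F n c a (i + j))"
  proof (induction n arbitrary: us ws i j)
    case (Suc n)
    from Suc.prems obtain u us' i1 i2 w ws' j1 j2
      where *: "us = u # us'" "i = i1 + i2" "u \<in> homog V F c b i1" "us' \<in> thomog V F n c b i2"
        "ws = w # ws'" "j = j1 + j2" "w \<in> homog V F b a j1" "ws' \<in> thomog V F n b a j2"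
      by (metis thomog_SucE)
    have "free_comp F (bas u) (bas w) \<otimes> tensor_comp F n (bas us') (bas ws' :: _ \<Rightarrow>\<^sub>0 'k)
      \<in> kspan (thomog V F (Suc n) c a ((i1 + j1) + (i2 + j2)))"
      by (intro ten_in_thomog free_comp_in_homog[of _ _ _ _ b] Suc.IH[OF *(4,8)]) (use * in auto)
    moreover have "length us' = n" using * by (simp add: thomog_def)
    moreover have "(i1 + j1) + (i2 + j2) = i + j" using * by simp
    ultimately show ?case
      using * by (simp add: tensor_comp_Cons)
  qed (auto simp: thomog_0 split: if_splits)
qed

text \<open>Splitting off first factors leaves the same three crossings on both sides:
  \<open>i2\<close> with \<open>j1\<close>, \<open>i2\<close> with \<open>k1\<close> and
  \<open>j2\<close> with \<open>k1\<close>. Associativity is what allows the image of a concatenated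
  word to be cut anywhere, see \<open>diag_word_comp\<close>.\<close>

lemma tensor_comp_assoc:
  fixes x :: "('o, 'g) word list \<Rightarrow>\<^sub>0 'k::field"
  assumes "x \<in> kspan (thomog V F n d c i)" "y \<in> kspan (thomog V F n c b j)" "z \<in> kspan (thomog V F n b a k)"
  shows "tensor_comp F n (tensor_comp F n x y) z = tensor_comp F n x (tensor_comp F n y z)"
proof -
  let ?E = "\<lambda>n x y z. tensor_comp F n (tensor_comp F n x y) z = tensor_comp F n x (tensor_comp F n y (z :: _ \<Rightarrow>\<^sub>0 'k))"
  have bas: "?E n (bas us) (bas vs) (bas ws)"
    if "us \<in> thomog V F n d c i" "vs \<in> thomog V F n c b j" "ws \<in> thomog V F n b a k" for us vs ws
    using that
  proof (induction n arbitrary: us vs ws i j k)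
    case (Suc n)
    from Suc.prems obtain u us' i1 i2 v vs' j1 j2 w ws' k1 k2
      where *: "us = u # us'" "i = i1 + i2" "u \<in> homog V F d c i1" "us' \<in> thomog V F n d c i2"
        "vs = v # vs'" "j = j1 + j2" "v \<in> homog V F c b j1" "vs' \<in> thomog V F n c b j2"
        "ws = w # ws'" "k = k1 + k2" "w \<in> homog V F b a k1" "ws' \<in> thomog V F n b a k2"
      by (elim thomog_SucE)
    have bas_in: "bas u \<in> kspan (homog V F d c i1)" "bas v \<in> kspan (homog V F c b j1)"
      "bas w \<in> kspan (homog V F b a k1)" "bas us' \<in> kspan (thomog V F n d c i2)"
      "bas vs' \<in> kspan (thomog V F n c b j2)" "bas ws' \<in> kspan (thomog V F n b a k2)"
      using * by auto
    have fc: "free_comp F (free_comp F (bas u) (bas v)) (bas w) = free_comp F (bas u) (free_comp F (bas v) (bas w))"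
      using * by (simp add: free_comp_bas homogD word_comp_out word_comp_assoc)
    let ?T = "tensor_comp F (Suc n)"
    have 1: "?T (bas u \<otimes> bas us') (bas v \<otimes> bas vs') =
        smul ((-1) ^ (i2 * j1)) (free_comp F (bas u) (bas v) \<otimes> tensor_comp F n (bas us') (bas vs'))"
      by (rule tensor_comp_ten[OF kspan_thomog_deg kspan_homog_deg]) (rule bas_in)+
    have 2: "?T (free_comp F (bas u) (bas v) \<otimes> tensor_comp F n (bas us') (bas vs')) (bas w \<otimes> bas ws') =
        smul ((-1) ^ ((i2 + j2) * k1)) (free_comp F (free_comp F (bas u) (bas v)) (bas w)
          \<otimes> tensor_comp F n (tensor_comp F n (bas us') (bas vs')) (bas ws'))"
      by (rule tensor_comp_ten[OF kspan_thomog_deg[OF tensor_comp_in_thomog] kspan_homog_deg]) (rule bas_in)+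
    have 3: "?T (bas v \<otimes> bas vs') (bas w \<otimes> bas ws') =
        smul ((-1) ^ (j2 * k1)) (free_comp F (bas v) (bas w) \<otimes> tensor_comp F n (bas vs') (bas ws'))"
      by (rule tensor_comp_ten[OF kspan_thomog_deg kspan_homog_deg]) (rule bas_in)+
    have 4: "?T (bas u \<otimes> bas us') (free_comp F (bas v) (bas w) \<otimes> tensor_comp F n (bas vs') (bas ws')) =
        smul ((-1) ^ (i2 * (j1 + k1))) (free_comp F (bas u) (free_comp F (bas v) (bas w))
          \<otimes> tensor_comp F n (bas us') (tensor_comp F n (bas vs') (bas ws')))"
      by (rule tensor_comp_ten[OF kspan_thomog_deg kspan_homog_deg[OF free_comp_in_homog]]) (rule bas_in)+
    have "(-1 :: 'k) ^ (i2 * j1) * (-1) ^ ((i2 + j2) * k1) = (-1) ^ (j2 * k1) * (-1) ^ (i2 * (j1 + k1))"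
      by (simp add: algebra_simps flip: power_add)
    then show ?case
      unfolding *(1,5,9) ten_bas[symmetric] 1 3
      by (simp only: linear_simps 2 4 fc Suc.IH[OF *(4,8,12)] pm.scale_scale)
  qed (simp add: thomog_0 split: if_splits)
  have 1: "?E n x (bas vs) (bas ws)"
    if "vs \<in> thomog V F n c b j" "ws \<in> thomog V F n b a k" for vs ws
    using assms(1) by (induction rule: kspan_induct) (simp_all only: bas that linear_simps)
  have 2: "?E n x y (bas ws)" if "ws \<in> thomog V F n b a k" for ws
    using assms(2) by (induction rule: kspan_induct) (simp_all only: 1 that linear_simps)
  show ?thesis
    using assms(3) by (induction rule: kspan_induct) (simp_all only: 2 linear_simps)
qed

lemma free_comp_unit_left:
  assumes "r \<in> kspan (homog V F b a i)"
  shows "free_comp F (bas ([], b)) r = r"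
proof (rule lin_eq_on[OF _ lin_id _ assms])
  show "lin (free_comp F (bas ([], b)))"
    by (rule bilin_lin2[OF bilin_free_comp lin_id])
  show "free_comp F (bas ([], b)) (bas w) = bas w" if "w \<in> homog V F b a i" for w
    using that by (cases w) (simp add: free_comp_bas homogD)
qed

lemma tensor_comp_unit_left:
  fixes x :: "('o, 'g) word list \<Rightarrow>\<^sub>0 'k::field"
  assumes "x \<in> kspan (thomog V F n b a i)"
  shows "tensor_comp F n (bas (replicate n ([], b))) x = x"
proof (rule lin_eq_on[OF _ lin_id _ assms])
  show "lin (tensor_comp F n (bas (replicate n ([], b))))"
    by (rule bilin_lin2[OF bilin_tensor_comp lin_id])
  show "tensor_comp F n (bas (replicate n ([], b))) (bas ws) = (bas ws :: _ \<Rightarrow>\<^sub>0 'k)" if "ws \<in> thomog V F n b a i" for ws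
    using that
  proof (induction n arbitrary: ws i)
    case (Suc n)
    then obtain w ws' j k where *: "ws = w # ws'" "w \<in> homog V F b a j" "ws' \<in> thomog V F n b a k"
      by (elim thomog_SucE)
    then have "free_comp F (bas ([], b)) (bas w) = (bas w :: _ \<Rightarrow>\<^sub>0 'k)"
      by (intro free_comp_unit_left) auto
    with * Suc.IH[of ws'] show ?case
      by (simp add: tensor_comp_Cons sum_list_replicate)
  qed (auto simp: thomog_0 split: if_splits)
qed

text \<open>Membership in \<open>thomog\<close> depends only on the multiset of factors, which a
  swap preserves.\<close>

lemma transpose_op_thomog:
  assumes "i < j" "j < n" "t \<in> kspan (thomog V F n b a k)"
  shows "transpose_op F i j t \<in> kspan (thomog V F n b a k)"
proof (rule lin_into[OF lin_transpose_op _ assms(3)])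
  fix ws assume ws: "ws \<in> thomog V F n b a k"
  then have "mset (ws[i := ws ! j, j := ws ! i]) = mset ws"
    using assms by (intro mset_swap) (auto simp: thomog_def)
  then have "ws[i := ws ! j, j := ws ! i] \<in> thomog V F n b a k"
    using ws unfolding thomog_def
    by (metis (mono_tags, lifting) mem_Collect_eq mset_eq_setD mset_map size_mset sum_mset_sum_list)
  then show "transpose_op F i j (bas ws) \<in> kspan (thomog V F n b a k)"
    by (simp add: transpose_op_bas)
qed

section \<open>Leibniz rule in the tensor power\<close>

text \<open>A differential linear on the whole space, with its other properties stated on words
  only; linearity propagates them. The given resolution is brought to this form in
  \<open>free_resolution_acyclic_dg\<close>.\<close>

locale linear_dg =
  fixes V :: "'o set"
    and F :: "('o, 'g) coloured_basis"
    and d :: "(('o, 'g) word \<Rightarrow>\<^sub>0 'k::field_char_0) \<Rightarrow> (('o, 'g) word \<Rightarrow>\<^sub>0 'k)"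
  assumes lin_d: "lin d"
    and d_Suc: "w \<in> homog V F b a (Suc i) \<Longrightarrow> d (bas w) \<in> kspan (homog V F b a i)"
    and d_0: "w \<in> homog V F b a 0 \<Longrightarrow> d (bas w) = 0"
    and d_d: "w \<in> homog V F b a i \<Longrightarrow> d (d (bas w)) = 0"
    and leibniz: "u \<in> homog V F c b i \<Longrightarrow> w \<in> homog V F b a j \<Longrightarrow>
      d (bas (word_comp u w)) =
        free_comp F (d (bas u)) (bas w) + smul ((-1) ^ i) (free_comp F (bas u) (d (bas w)))"
begin

abbreviation H where "H b a i \<equiv> kspan (homog V F b a i) :: (_ \<Rightarrow>\<^sub>0 'k) set"
abbreviation TH where "TH n b a i \<equiv> kspan (thomog V F n b a i) :: (_ \<Rightarrow>\<^sub>0 'k) set"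
abbreviation tdiff ("\<partial>") where "\<partial> \<equiv> tensor_diff F d"

lemma d_H_Suc: "r \<in> H b a (Suc i) \<Longrightarrow> d r \<in> H b a i"
  by (rule lin_into[OF lin_d d_Suc])

lemma d_H_0: "r \<in> H b a 0 \<Longrightarrow> d r = 0"
  by (rule lin_eq_on[OF lin_d lin_zero d_0])

lemma d_d_H: "r \<in> H b a i \<Longrightarrow> d (d r) = 0"
  by (rule lin_eq_on[OF lin_comp[OF lin_d lin_d] lin_zero d_d])

text \<open>Truncated subtraction lets one statement serve all degrees: in degree 0 the differential
  vanishes, and 0 lies in every piece.\<close>

lemma d_H: "r \<in> H b a i \<Longrightarrow> d r \<in> H b a (i - 1)"
  by (cases i) (auto simp: d_H_0 d_H_Suc)

lemma leibniz_H:
  assumes "r \<in> H c b i" "s \<in> H b a j"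
  shows "d (free_comp F r s) = free_comp F (d r) s + smul ((-1) ^ i) (free_comp F r (d s))"
proof (rule bilin_eq_on[OF _ _ _ assms, of "\<lambda>r s. d (free_comp F r s)"])
  show "bilin (\<lambda>r s. d (free_comp F r s))"
    "bilin (\<lambda>r s. free_comp F (d r) s + smul ((-1) ^ i) (free_comp F r (d s)))"
    by (intro bilinI lin_comp[OF lin_d] lin_plus lin_scaled bilin_lin1[OF bilin_free_comp]
        bilin_lin2[OF bilin_free_comp] lin_d lin_id)+
  show "d (free_comp F (bas u) (bas w)) =
      free_comp F (d (bas u)) (bas w) + smul ((-1) ^ i) (free_comp F (bas u) (d (bas w)))"
    if "u \<in> homog V F c b i" "w \<in> homog V F b a j" for u w
    using that leibniz[OF that] by (auto simp: free_comp_bas homogD)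
qed

lemma diff_ten: "r \<in> H b a i \<Longrightarrow> \<partial> (r \<otimes> t) = d r \<otimes> t + smul ((-1) ^ i) (r \<otimes> \<partial> t)"
  by (rule tensor_diff_ten[OF lin_d kspan_homog_deg])

text \<open>The two claims are proved together. When the tail has degree k = 0, the identity i - 1 =
  j + (k - 1) may fail for truncated subtraction, and the vanishing of the differential of the tail
  takes its place.\<close>

lemma diff_TH_bas: "ws \<in> thomog V F n b a i \<Longrightarrow>
  \<partial> (bas ws) \<in> TH n b a (i - 1) \<and> (i = 0 \<longrightarrow> \<partial> (bas ws) = 0)"
proof (induction n arbitrary: ws i)
  case (Suc n)
  then obtain w vs j k where ws: "ws = w # vs" "i = j + k" "w \<in> homog V F b a j" "vs \<in> thomog V F n b a k"
    by (elim thomog_SucE)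
  then have bas: "bas w \<in> H b a j" "bas vs \<in> TH n b a k"
    by auto
  have "d (bas w) \<otimes> bas vs \<in> TH (Suc n) b a (i - 1)"
  proof (cases j)
    case 0
    then show ?thesis using ws by (simp add: d_0 linear_simps)
  next
    case (Suc j')
    have "d (bas w) \<otimes> bas vs \<in> TH (Suc n) b a (j' + k)"
      by (rule ten_in_thomog[OF d_H_Suc]) (use bas Suc in auto)
    then show ?thesis using ws Suc by simp
  qed
  moreover have "bas w \<otimes> \<partial> (bas vs) \<in> TH (Suc n) b a (i - 1)"
  proof (cases k)
    case 0
    then show ?thesis using Suc.IH[OF ws(4)] by (simp add: linear_simps)
  next
    case (Suc k')
    have "bas w \<otimes> \<partial> (bas vs) \<in> TH (Suc n) b a (j + (k - 1))"
      by (rule ten_in_thomog) (use bas Suc.IH[OF ws(4)] in auto)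
    then show ?thesis using ws Suc by simp
  qed
  ultimately have "\<partial> (bas ws) \<in> TH (Suc n) b a (i - 1)"
    unfolding ws(1) tensor_diff_Cons by (intro kspan_add kspan_smul)
  moreover have "\<partial> (bas ws) = 0" if "i = 0"
    using that ws Suc.IH[OF ws(4)] by (simp add: tensor_diff_Cons linear_simps d_0)
  ultimately show ?case by blast
qed (auto simp: thomog_0 split: if_splits)

lemma diff_TH: "t \<in> TH n b a i \<Longrightarrow> \<partial> t \<in> TH n b a (i - 1)"
  by (rule lin_into[OF lin_tensor_diff]) (use diff_TH_bas in auto)

lemma diff_TH_0: "t \<in> TH n b a 0 \<Longrightarrow> \<partial> t = 0"
  by (rule lin_eq_on[OF lin_tensor_diff lin_zero]) (use diff_TH_bas in auto)

text \<open>After the first factors are split off, the differential can hit \<open>u\<close>,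
  \<open>w\<close>, \<open>us'\<close> or \<open>ws'\<close>. The first two cases are the Leibniz
  rule of the operad, the last two the induction hypothesis; what remains is to compare
  signs.\<close>

lemma diff_tensor_comp:
  assumes "x \<in> TH n c b i" "y \<in> TH n b a j"
  shows "\<partial> (tensor_comp F n x y) = tensor_comp F n (\<partial> x) y + smul ((-1) ^ i) (tensor_comp F n x (\<partial> y))"
proof (rule bilin_eq_on[OF _ _ _ assms, of "\<lambda>x y. \<partial> (tensor_comp F n x y)"])
  show "bilin (\<lambda>x y. \<partial> (tensor_comp F n x y))"
    "bilin (\<lambda>x y. tensor_comp F n (\<partial> x) y + smul ((-1) ^ i) (tensor_comp F n x (\<partial> y)))"
    by (intro bilinI lin_comp[OF lin_tensor_diff] lin_plus lin_scaled bilin_lin1[OF bilin_tensor_comp]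
        bilin_lin2[OF bilin_tensor_comp] lin_tensor_diff lin_id)+
  show "\<partial> (tensor_comp F n (bas us) (bas ws)) =
      tensor_comp F n (\<partial> (bas us)) (bas ws) + smul ((-1) ^ i) (tensor_comp F n (bas us) (\<partial> (bas ws)))"
    if "us \<in> thomog V F n c b i" "ws \<in> thomog V F n b a j" for us ws
    using that
  proof (induction n arbitrary: us ws i j)
    case (Suc n)
    from Suc.prems obtain u us' A B w ws' C D
      where *: "us = u # us'" "i = A + B" "u \<in> homog V F c b A" "us' \<in> thomog V F n c b B"
        "ws = w # ws'" "j = C + D" "w \<in> homog V F b a C" "ws' \<in> thomog V F n b a D"
      by (elim thomog_SucE)
    have bas: "bas u \<in> H c b A" "bas w \<in> H b a C" "bas us' \<in> TH n c b B" "bas ws' \<in> TH n b a D"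
      using * by auto
    note bdeg = bas(1,2)[THEN kspan_homog_deg] bas(3,4)[THEN kspan_thomog_deg]
    let ?T = "tensor_comp F (Suc n)" and ?t = "tensor_comp F n" and ?c = "free_comp F"
    have 1: "?T (bas u \<otimes> (bas us' :: _ \<Rightarrow>\<^sub>0 'k)) (bas w \<otimes> bas ws') =
        smul ((-1) ^ (B * C)) (?c (bas u) (bas w) \<otimes> ?t (bas us') (bas ws'))"
      by (rule tensor_comp_ten[OF bdeg(3,2)])
    have 2: "\<partial> (?c (bas u) (bas w) \<otimes> ?t (bas us') (bas ws')) =
        (?c (d (bas u)) (bas w) + smul ((-1) ^ A) (?c (bas u) (d (bas w)))) \<otimes> ?t (bas us') (bas ws')
        + smul ((-1) ^ (A + C)) (?c (bas u) (bas w) \<otimes>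
           (?t (\<partial> (bas us')) (bas ws') + smul ((-1) ^ B) (?t (bas us') (\<partial> (bas ws')))))"
      unfolding Suc.IH[OF *(4,8), symmetric] leibniz_H[OF bas(1,2), symmetric]
      by (rule diff_ten[OF free_comp_in_homog[OF bas(1,2)]])
    have 3: "?T (d (bas u) \<otimes> bas us') (bas w \<otimes> bas ws') =
        smul ((-1) ^ (B * C)) (?c (d (bas u)) (bas w) \<otimes> ?t (bas us') (bas ws'))"
      by (rule tensor_comp_ten[OF bdeg(3,2)])
    have 4: "?T (bas u \<otimes> \<partial> (bas us')) (bas w \<otimes> bas ws') =
        smul ((-1) ^ ((B - 1) * C)) (?c (bas u) (bas w) \<otimes> ?t (\<partial> (bas us')) (bas ws'))"
      by (rule tensor_comp_ten[OF kspan_thomog_deg[OF diff_TH[OF bas(3)]] bdeg(2)])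
    have 5: "?T (bas u \<otimes> bas us') (d (bas w) \<otimes> bas ws') =
        smul ((-1) ^ (B * (C - 1))) (?c (bas u) (d (bas w)) \<otimes> ?t (bas us') (bas ws'))"
      by (rule tensor_comp_ten[OF bdeg(3) kspan_homog_deg[OF d_H[OF bas(2)]]])
    have 6: "?T (bas u \<otimes> bas us') (bas w \<otimes> \<partial> (bas ws')) =
        smul ((-1) ^ (B * C)) (?c (bas u) (bas w) \<otimes> ?t (bas us') (\<partial> (bas ws')))"
      by (rule tensor_comp_ten[OF bdeg(3,2)])
    have 7: "\<partial> (bas u \<otimes> bas us') = d (bas u) \<otimes> bas us' + smul ((-1) ^ A) (bas u \<otimes> \<partial> (bas us'))"
      "\<partial> (bas w \<otimes> bas ws') = d (bas w) \<otimes> bas ws' + smul ((-1) ^ C) (bas w \<otimes> \<partial> (bas ws'))"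
      by (rule diff_ten[OF bas(1)], rule diff_ten[OF bas(2)])
    \<comment> \<open>For B = 0 or C = 0 the truncated exponents in \<open>4\<close> and
      \<open>5\<close> need not have the right parity, but then the differential in that term is
      zero.\<close>
    have B: "\<partial> (bas us') = 0 \<or> B = Suc (B - 1)" "d (bas w) = 0 \<or> C = Suc (C - 1)"
      using diff_TH_0[of "bas us'" n c b] d_H_0[of "bas w" b a] bas by (cases B; cases C; auto)+
    show ?case
      unfolding *(1,5) ten_bas[symmetric] 1 7
      by (simp only: linear_simps 2 3 4 5 6 *(2))
        (use B in \<open>elim disjE; auto simp: linear_simps minus_one_power_iff algebra_simps\<close>)
  qed (auto simp: thomog_0 linear_simps split: if_splits)
qed

end

section \<open>Compatibility with the symmetric group\<close>

lemma minus_one_power_cong: "even m = even n \<Longrightarrow> (-1) ^ m = ((-1) ^ n :: 'a::ring_1)"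
  by (simp add: minus_one_power_iff)

text \<open>When the exchanged factors are the first two, the sign exponents of the two sides differ
  by 2A'C, with A' the degree of the second factor of \<open>us\<close> and C that of the first
  factor of \<open>ws\<close>. Positions further right are reduced to this case by removing first
  factors.\<close>

lemma transpose_op_tensor_comp_adjacent:
  fixes V :: "'o set" and F :: "('o, 'g) coloured_basis"
  assumes "Suc k < n" "us \<in> thomog V F n c b i" "ws \<in> thomog V F n b a j"
  shows "transpose_op F k (Suc k) (tensor_comp F n (bas us) (bas ws)) =
    (tensor_comp F n (transpose_op F k (Suc k) (bas us)) (transpose_op F k (Suc k) (bas ws)) :: _ \<Rightarrow>\<^sub>0 'k::field)"
  using assms
proof (induction k arbitrary: n us ws i j)
  case (0 n)
  define m where "m = n - 2"
  have n: "n = Suc (Suc m)"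
    using 0(1) by (simp add: m_def)
  from 0 obtain u u' us' A A' B w w' ws' C C' D
    where *: "us = u # u' # us'" "i = A + (A' + B)" "u \<in> homog V F c b A" "u' \<in> homog V F c b A'"
      "us' \<in> thomog V F m c b B"
      "ws = w # w' # ws'" "j = C + (C' + D)" "w \<in> homog V F b a C" "w' \<in> homog V F b a C'"
      "ws' \<in> thomog V F m b a D"
    unfolding n by (elim thomog_SucE) auto
  let ?x = "bas us' :: _ \<Rightarrow>\<^sub>0 'k"
  have bas: "bas u \<in> kspan (homog V F c b A)" "bas u' \<in> kspan (homog V F c b A')"
    "?x \<in> kspan (thomog V F m c b B)"
    "bas w \<in> kspan (homog V F b a C)" "bas w' \<in> kspan (homog V F b a C')"
    using * by auto
  let ?T = "tensor_comp F (Suc (Suc m))" and ?t = "tensor_comp F (Suc m)" and ?c = "free_comp F"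
  note tc = tensor_comp_ten[OF kspan_thomog_deg kspan_homog_deg]
  have 1: "?T (bas u \<otimes> bas u' \<otimes> ?x) (bas w \<otimes> bas w' \<otimes> bas ws') =
      smul ((-1) ^ ((A' + B) * C)) (?c (bas u) (bas w) \<otimes> ?t (bas u' \<otimes> ?x) (bas w' \<otimes> bas ws'))"
    by (rule tc[OF ten_in_thomog]) (rule bas)+
  have 2: "?t (bas u' \<otimes> ?x) (bas w' \<otimes> bas ws') =
      smul ((-1) ^ (B * C')) (?c (bas u') (bas w') \<otimes> tensor_comp F m ?x (bas ws'))"
    by (rule tc) (rule bas)+
  have 3: "transpose_op F 0 (Suc 0) (?c (bas u) (bas w) \<otimes> ?c (bas u') (bas w') \<otimes> tensor_comp F m ?x (bas ws'))
    = smul ((-1) ^ ((A + C) * (A' + C'))) (?c (bas u') (bas w') \<otimes> ?c (bas u) (bas w) \<otimes> tensor_comp F m ?x (bas ws'))"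
    by (rule transpose_op_0_ten[OF kspan_homog_deg[OF free_comp_in_homog] kspan_homog_deg[OF free_comp_in_homog]])
      (rule bas)+
  have 4: "transpose_op F 0 (Suc 0) (bas u \<otimes> bas u' \<otimes> ?x) = smul ((-1) ^ (A * A')) (bas u' \<otimes> bas u \<otimes> ?x)"
    by (rule transpose_op_0_ten[OF kspan_homog_deg kspan_homog_deg]) (rule bas)+
  have 5: "transpose_op F 0 (Suc 0) (bas w \<otimes> bas w' \<otimes> bas ws' :: _ \<Rightarrow>\<^sub>0 'k) =
      smul ((-1) ^ (C * C')) (bas w' \<otimes> bas w \<otimes> bas ws')"
    by (rule transpose_op_0_ten[OF kspan_homog_deg kspan_homog_deg]) (rule bas)+
  have 6: "?T (bas u' \<otimes> bas u \<otimes> ?x) (bas w' \<otimes> bas w \<otimes> bas ws') =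
      smul ((-1) ^ ((A + B) * C')) (?c (bas u') (bas w') \<otimes> ?t (bas u \<otimes> ?x) (bas w \<otimes> bas ws'))"
    by (rule tc[OF ten_in_thomog]) (rule bas)+
  have 7: "?t (bas u \<otimes> ?x) (bas w \<otimes> bas ws') =
      smul ((-1) ^ (B * C)) (?c (bas u) (bas w) \<otimes> tensor_comp F m ?x (bas ws'))"
    by (rule tc) (rule bas)+
  show ?case
    unfolding *(1,6) n ten_bas[symmetric]
    by (simp only: linear_simps 1 2 3 4 5 6 7 pm.scale_scale)
      (intro arg_cong2[where f = smul] refl, simp only: power_add[symmetric],
        intro minus_one_power_cong, auto)
next
  case (Suc k n)
  define m where "m = n - 1"
  have n: "n = Suc m" "Suc k < m"
    using Suc.prems(1) by (simp_all add: m_def)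
  from Suc obtain u us' A B w ws' C D
    where *: "us = u # us'" "i = A + B" "u \<in> homog V F c b A" "us' \<in> thomog V F m c b B"
      "ws = w # ws'" "j = C + D" "w \<in> homog V F b a C" "ws' \<in> thomog V F m b a D"
    unfolding n by (elim thomog_SucE) auto
  let ?x = "bas us' :: _ \<Rightarrow>\<^sub>0 'k"
  have bas: "bas u \<in> kspan (homog V F c b A)" "?x \<in> kspan (thomog V F m c b B)"
    "bas w \<in> kspan (homog V F b a C)"
    using * by auto
  let ?s = "transpose_op F k (Suc k)"
  have 1: "tensor_comp F (Suc m) (bas u \<otimes> ?x) (bas w \<otimes> bas ws') =
      smul ((-1) ^ (B * C)) (free_comp F (bas u) (bas w) \<otimes> tensor_comp F m ?x (bas ws'))"
    by (rule tensor_comp_ten[OF kspan_thomog_deg kspan_homog_deg]) (rule bas)+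
  have 2: "tensor_comp F (Suc m) (bas u \<otimes> ?s ?x) (bas w \<otimes> ?s (bas ws')) =
      smul ((-1) ^ (B * C)) (free_comp F (bas u) (bas w) \<otimes> tensor_comp F m (?s ?x) (?s (bas ws')))"
    by (rule tensor_comp_ten[OF kspan_thomog_deg kspan_homog_deg], rule transpose_op_thomog)
      (use n bas in auto)
  show ?case
    unfolding *(1,5) n ten_bas[symmetric]
    by (simp only: linear_simps 1 2 transpose_op_Suc_ten Suc.IH[OF n(2) *(4,8)])
qed

lemma transpose_op_tensor_comp:
  fixes V :: "'o set" and F :: "('o, 'g) coloured_basis"
  assumes "k < l" "l < n" "x \<in> kspan (thomog V F n c b i)" "y \<in> kspan (thomog V F n b a j)"
  shows "transpose_op F k l (tensor_comp F n x y) =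
    (tensor_comp F n (transpose_op F k l x) (transpose_op F k l y) :: _ \<Rightarrow>\<^sub>0 'k::field)"
proof -
  let ?X = "kspan (thomog V F n c b i) :: (_ \<Rightarrow>\<^sub>0 'k) set" and ?Y = "kspan (thomog V F n b a j) :: (_ \<Rightarrow>\<^sub>0 'k) set"
    and ?Z = "kspan (thomog V F n c a (i + j)) :: (_ \<Rightarrow>\<^sub>0 'k) set"
  \<comment> \<open>Preservation of the two pieces is part of the induction property; without it the
    commutation rule would not pass to composites.\<close>
  let ?P = "\<lambda>f. f ` ?X \<subseteq> ?X \<and> f ` ?Y \<subseteq> ?Y \<and> (\<forall>x\<in>?X. \<forall>y\<in>?Y. f (tensor_comp F n x y) = tensor_comp F n (f x) (f y))"
  have "?P (transpose_op F k l)"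
    using assms(1,2)
  proof (induction rule: transpose_op_induct)
    case (adjacent k)
    have "transpose_op F k (Suc k) (tensor_comp F n x y) =
      tensor_comp F n (transpose_op F k (Suc k) x) (transpose_op F k (Suc k) y)"
      if "x \<in> ?X" "y \<in> ?Y" for x y
    proof (rule bilin_eq_on[OF _ _ _ that])
      show "bilin (\<lambda>x y. transpose_op F k (Suc k) (tensor_comp F n x y))"
        by (intro bilinI lin_comp[OF lin_transpose_op] bilin_lin1[OF bilin_tensor_comp]
            bilin_lin2[OF bilin_tensor_comp] lin_id)
      show "bilin (\<lambda>x y. tensor_comp F n (transpose_op F k (Suc k) x) (transpose_op F k (Suc k) y))"
        by (intro bilinI bilin_lin1[OF bilin_tensor_comp] bilin_lin2[OF bilin_tensor_comp] lin_transpose_op)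
    qed (rule transpose_op_tensor_comp_adjacent[OF adjacent])
    then show ?case
      using adjacent by (auto intro: transpose_op_thomog)
  next
    case (comp f g)
    then show ?case by (auto simp: image_subset_iff)
  next
    case (cong f g)
    have eq: "f t = g t" if "t \<in> kspan {ws. length ws = n}" for t
      by (rule lin_eq_on[OF cong(2,3) _ that]) (simp add: cong(4))
    have "t \<in> kspan {ws. length ws = n}" if "t \<in> ?X \<or> t \<in> ?Y \<or> t \<in> ?Z" for t
      using that by (auto simp: kspan_def thomog_def)
    then have "f t = g t" if "t \<in> ?X \<or> t \<in> ?Y \<or> t \<in> ?Z" for t
      using that eq by blast
    moreover have "tensor_comp F n x y \<in> ?Z" if "x \<in> ?X" "y \<in> ?Y" for x y
      using that by (rule tensor_comp_in_thomog)
    ultimately show ?case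
      using cong(1) by (simp add: image_subset_iff)
  qed
  then show ?thesis using assms(3,4) by blast
qed

section \<open>Invariant tensors and finiteness of orbits\<close>

lemma sigma_stableI:
  assumes "\<And>i j. i < j \<Longrightarrow> j < n \<Longrightarrow> transpose_op F i j t = t"
  shows "sigma_stable F n t"
  unfolding sigma_stable_def
proof
  show "\<sigma> t = t" if "\<sigma> \<in> sigma_ops F n" for \<sigma>
    using that by induction (simp_all add: assms)
qed

lemma sigma_stableD:
  assumes "sigma_stable F n t" "i < j" "j < n"
  shows "transpose_op F i j t = t"
  using assms sigma_ops.intros(2)[OF sigma_ops.intros(1) assms(2,3)] unfolding sigma_stable_def by force

lemma sigma_stable_iff:
  "sigma_stable F n t \<longleftrightarrow> (\<forall>i j. i < j \<and> j < n \<longrightarrow> transpose_op F i j t = t)"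
  by (auto intro: sigma_stableI sigma_stableD)

lemma sigma_stable_span:
  assumes "p \<in> kspan S" "lin f" "\<And>w. w \<in> S \<Longrightarrow> sigma_stable F n (f (bas w))"
  shows "sigma_stable F n (f p)"
  unfolding sigma_stable_iff
proof (intro allI impI)
  fix i j assume "i < j \<and> j < n"
  then show "transpose_op F i j (f p) = f p"
    by (intro lin_eq_on[OF lin_comp[OF lin_transpose_op assms(2)] assms(2) _ assms(1)])
      (use assms(3) in \<open>simp add: sigma_stable_iff\<close>)
qed

text \<open>Makes (C1) compatible with (C5): invariance on generators is inherited by all
  composites.\<close>

lemma sigma_stable_tensor_comp:
  assumes "x \<in> kspan (thomog V F n c b i)" "y \<in> kspan (thomog V F n b a j)"
    "sigma_stable F n x" "sigma_stable F n y"
  shows "sigma_stable F n (tensor_comp F n x y)"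
  using assms by (auto simp: sigma_stable_iff transpose_op_tensor_comp)

lemma sigma_ops_lin: "\<sigma> \<in> sigma_ops F n \<Longrightarrow> lin \<sigma>"
proof (induction rule: sigma_ops.induct)
  case (2 \<sigma> i j)
  then show ?case using lin_comp[OF lin_transpose_op] by (simp add: o_def)
qed (simp add: lin_id id_def)

text \<open>Each operator sends a basis tensor to plus or minus a basis tensor of the same length in
  the same letters, which leaves finitely many values \<open>B ws\<close>. By linearity the image of
  \<open>t\<close> is determined by the values on its finitely many keys.\<close>

lemma finite_orbit:
  fixes t :: "('o, 'g) word list \<Rightarrow>\<^sub>0 'k::field"
  assumes "t \<in> kspan {ws. length ws = n}"
  shows "finite ((\<lambda>\<sigma>. \<sigma> t) ` sigma_ops F n)"
proof -
  define B where "B ws = (\<lambda>(c, vs). smul c (bas vs) :: _ \<Rightarrow>\<^sub>0 'k) `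
    ({1, -1} \<times> {vs. set vs \<subseteq> set ws \<and> length vs = n})" for ws :: "('o, 'g) word list"
  have B: "\<sigma> (bas ws) \<in> B ws" if "\<sigma> \<in> sigma_ops F n" "length ws = n" for \<sigma> ws
    using that
  proof (induction rule: sigma_ops.induct)
    case 1
    then show ?case by (force simp: B_def intro: image_eqI[of _ _ "(1, ws)"])
  next
    case (2 \<sigma> i j)
    then obtain c vs where *: "c \<in> {1, -1}" "set vs \<subseteq> set ws" "length vs = n" "\<sigma> (bas ws) = smul c (bas vs)"
      by (auto simp: B_def)
    let ?us = "vs[i := vs ! j, j := vs ! i]"
    have "set ?us \<subseteq> set ws"
      using * 2 by (metis mset_eq_setD mset_swap order.strict_trans)
    moreover obtain m where "transpose_op F i j (bas vs) = smul ((-1) ^ m) (bas ?us :: _ \<Rightarrow>\<^sub>0 'k)"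
      using transpose_op_bas by blast
    then have "(transpose_op F i j \<circ> \<sigma>) (bas ws) = smul (c * (-1) ^ m) (bas ?us)"
      using * by (simp add: lin_smul[OF lin_transpose_op])
    moreover have "c * (-1) ^ m \<in> {1, -1}"
      using * by (auto simp: minus_one_power_iff)
    ultimately show ?case
      using * unfolding B_def by (intro image_eqI[of _ _ "(c * (-1) ^ m, ?us)"]) simp_all
  qed
  let ?K = "Poly_Mapping.keys t"
  have "\<sigma> t \<in> (\<lambda>f. \<Sum>ws\<in>?K. smul (Poly_Mapping.lookup t ws) (f ws)) ` PiE ?K B"
    if "\<sigma> \<in> sigma_ops F n" for \<sigma>
  proof (rule image_eqI)
    have "\<sigma> t = \<sigma> (\<Sum>ws\<in>?K. smul (Poly_Mapping.lookup t ws) (bas ws))"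
      by (simp only: sum_bas)
    also have "\<dots> = (\<Sum>ws\<in>?K. smul (Poly_Mapping.lookup t ws) (restrict (\<lambda>ws. \<sigma> (bas ws)) ?K ws))"
      using sigma_ops_lin[OF that] by (simp add: lin_sum lin_smul)
    finally show "\<sigma> t = \<dots>" .
    show "restrict (\<lambda>ws. \<sigma> (bas ws)) ?K \<in> PiE ?K B"
      using assms B[OF that] by (auto simp: kspan_def)
  qed
  moreover have "finite (PiE ?K B)"
    by (intro finite_PiE) (auto simp: B_def finite_lists_length_eq)
  ultimately show ?thesis
    by (meson finite_imageI finite_subset image_subsetI)
qed

section \<open>Equivariance of the differential and averaging\<close>

context linear_dg
begin

lemma diff_transpose_adjacent:
  assumes "Suc k < n" "ws \<in> thomog V F n b a i"
  shows "\<partial> (transpose_op F k (Suc k) (bas ws)) = transpose_op F k (Suc k) (\<partial> (bas ws))"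
  using assms
proof (induction k arbitrary: n ws i)
  case (0 n)
  define m where "m = n - 2"
  have n: "n = Suc (Suc m)"
    using 0(1) by (simp add: m_def)
  from 0 obtain u w ws' A B C
    where *: "ws = u # w # ws'" "u \<in> homog V F b a A" "w \<in> homog V F b a B"
    unfolding n by (elim thomog_SucE) auto
  let ?T = "transpose_op F 0 (Suc 0)" and ?x = "bas ws' :: _ \<Rightarrow>\<^sub>0 'k"
  have bas: "bas u \<in> H b a A" "bas w \<in> H b a B"
    using * by auto
  note tr = transpose_op_0_ten[OF kspan_homog_deg kspan_homog_deg]
  have 1: "?T (bas u \<otimes> bas w \<otimes> t) = smul ((-1) ^ (A * B)) (bas w \<otimes> bas u \<otimes> t :: _ \<Rightarrow>\<^sub>0 'k)" for t
    by (rule tr) (rule bas)+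
  have 2: "?T (d (bas u) \<otimes> bas w \<otimes> t) = smul ((-1) ^ ((A - 1) * B)) (bas w \<otimes> d (bas u) \<otimes> t)" for t
    by (rule tr[OF d_H]) (rule bas)+
  have 3: "?T (bas u \<otimes> d (bas w) \<otimes> t) = smul ((-1) ^ (A * (B - 1))) (d (bas w) \<otimes> bas u \<otimes> t)" for t
    by (rule tr[OF _ d_H]) (rule bas)+
  \<comment> \<open>As in \<open>diff_tensor_comp\<close>, a truncated degree in \<open>2\<close> or
    \<open>3\<close> can give a wrong sign only where the differential vanishes.\<close>
  have B: "d (bas u) = 0 \<or> A = Suc (A - 1)" "d (bas w) = 0 \<or> B = Suc (B - 1)"
    using d_H_0[of "bas u" b a] d_H_0[of "bas w" b a] bas by (cases A; cases B; auto)+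
  show ?case
    unfolding *(1) ten_bas[symmetric]
    by (simp only: 1 2 3 linear_simps diff_ten[OF bas(1)] diff_ten[OF bas(2)])
      (use B in \<open>elim disjE; auto simp: linear_simps minus_one_power_iff algebra_simps\<close>)
next
  case (Suc k n)
  define m where "m = n - 1"
  have n: "n = Suc m" "Suc k < m"
    using Suc.prems(1) by (simp_all add: m_def)
  from Suc obtain w ws' A B
    where *: "ws = w # ws'" "w \<in> homog V F b a A" "ws' \<in> thomog V F m b a B"
    unfolding n by (elim thomog_SucE) auto
  have bas: "bas w \<in> H b a A"
    using * by auto
  show ?case
    unfolding *(1) ten_bas[symmetric]
    by (simp only: linear_simps transpose_op_Suc_ten diff_ten[OF bas] Suc.IH[OF n(2) *(3)])
qed

lemma diff_transpose:
  assumes "k < l" "l < n" "x \<in> TH n b a i"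
  shows "\<partial> (transpose_op F k l x) = transpose_op F k l (\<partial> x)"
proof -
  let ?P = "\<lambda>f. (\<forall>i. f ` TH n b a i \<subseteq> TH n b a i) \<and> (\<forall>i. \<forall>x\<in>TH n b a i. \<partial> (f x) = f (\<partial> x))"
  have "?P (transpose_op F k l)"
    using assms(1,2)
  proof (induction rule: transpose_op_induct)
    case (adjacent k)
    have "\<partial> (transpose_op F k (Suc k) x) = transpose_op F k (Suc k) (\<partial> x)" if "x \<in> TH n b a i" for x i
      by (rule lin_eq_on[OF lin_comp[OF lin_tensor_diff lin_transpose_op]
            lin_comp[OF lin_transpose_op lin_tensor_diff] _ that])
        (rule diff_transpose_adjacent[OF adjacent])
    then show ?case
      using adjacent by (auto intro: transpose_op_thomog)
  next
    case (comp f g)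
    then show ?case by (simp add: image_subset_iff) metis
  next
    case (cong f g)
    have eq: "f t = g t" if "t \<in> kspan {ws. length ws = n}" for t
      by (rule lin_eq_on[OF cong(2,3) _ that]) (simp add: cong(4))
    have "t \<in> kspan {ws. length ws = n}" if "t \<in> TH n b a i" for t i
      using that by (auto simp: kspan_def thomog_def)
    then have "f t = g t" if "t \<in> TH n b a i" for t i
      using that eq by blast
    moreover have "\<partial> t \<in> TH n b a (i - 1)" if "t \<in> TH n b a i" for t i
      using that by (rule diff_TH)
    ultimately show ?case
      using cong(1) by (simp add: image_subset_iff) metis
  qed
  then show ?thesis using assms(3) by blast
qed

lemma sigma_ops_TH:
  assumes "\<sigma> \<in> sigma_ops F n" "x \<in> TH n b a i"
  shows "\<sigma> x \<in> TH n b a i \<and> \<partial> (\<sigma> x) = \<sigma> (\<partial> x)"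
  using assms by (induction rule: sigma_ops.induct) (auto simp: diff_transpose transpose_op_thomog)

text \<open>
  Averaging over the orbit of \<open>x\<close>, rather than over the group, avoids defining the action of an
  arbitrary permutation: the orbit is finite and each transposition permutes it.
\<close>

lemma symmetrise:
  assumes x: "x \<in> TH n b a i" and "sigma_stable F n (\<partial> x)"
  obtains y where "y \<in> TH n b a i" "sigma_stable F n y" "\<partial> y = \<partial> x"
proof -
  define S where "S = (\<lambda>\<sigma>. \<sigma> x) ` sigma_ops F n"
  have S: "s \<in> TH n b a i" "\<partial> s = \<partial> x" if "s \<in> S" for s
    using that sigma_ops_TH[OF _ x] assms(2) by (auto simp: S_def sigma_stable_def)
  have len: "kspan (thomog V F n b a i) \<subseteq> (kspan {ws. length ws = n} :: (_ \<Rightarrow>\<^sub>0 'k) set)"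
    by (rule kspan_mono) (auto simp: thomog_def)
  then have "finite S"
    unfolding S_def using x by (intro finite_orbit) auto
  have "x \<in> S"
    unfolding S_def using sigma_ops.intros(1) by (intro image_eqI[of _ _ id]) auto
  \<comment> \<open>All members of the orbit have the boundary of \<open>x\<close>, hence so has
    their mean. The number \<open>card S\<close> is positive because \<open>x\<close> belongs to
    \<open>S\<close>, hence invertible in characteristic 0.\<close>
  define y where "y = smul (1 / of_nat (card S)) (\<Sum>S)"
  have y: "y \<in> TH n b a i"
    unfolding y_def by (intro kspan_smul kspan_sum S)
  have "\<partial> (\<Sum>S) = (\<Sum>s\<in>S. \<partial> x)"
    using S(2) by (simp add: lin_sum[OF lin_tensor_diff])
  also have "\<dots> = smul (of_nat (card S)) (\<partial> x)"
    by (rule pm.sum_constant_scale)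
  finally have dy: "\<partial> y = \<partial> x"
    using \<open>finite S\<close> \<open>x \<in> S\<close> by (auto simp: y_def linear_simps)
  have "sigma_stable F n y"
  proof (rule sigma_stableI)
    fix k l assume kl: "k < l" "l < n"
    have "transpose_op F k l ` S \<subseteq> S"
      unfolding S_def using kl by (auto intro!: image_eqI[OF _ sigma_ops.intros(2)])
    moreover have inj: "inj_on (transpose_op F k l) S"
    proof (rule inj_on_inverseI)
      show "transpose_op F k l (transpose_op F k l s) = s" if "s \<in> S" for s
      proof (rule transpose_op_involutive[OF kl(1)])
        have "kspan {ws. length ws = n} \<subseteq> (kspan {ws. l < length ws} :: (_ \<Rightarrow>\<^sub>0 'k) set)"
          using kl by (intro kspan_mono) auto
        then show "s \<in> kspan {ws. l < length ws}"
          using S(1)[OF that] len by blast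
      qed
    qed
    ultimately have "transpose_op F k l ` S = S"
      using \<open>finite S\<close> by (intro endo_inj_surj)
    with inj have "\<Sum>S = (\<Sum>s\<in>S. transpose_op F k l s)"
      by (metis sum.reindex_cong)
    also have "\<dots> = transpose_op F k l (\<Sum>S)"
      by (rule lin_sum[OF lin_transpose_op, symmetric])
    finally show "transpose_op F k l y = y"
      by (simp add: y_def linear_simps)
  qed
  with y dy that show thesis by blast
qed

end

section \<open>Acyclicity of the tensor power\<close>

text \<open>The sum of p \<otimes> ... \<otimes> p \<otimes> h \<otimes> 1 \<otimes> ... \<otimes> 1
  over the positions of h. There is no Koszul sign because the p to be used vanishes in positive
  degrees, so h passes only factors of degree 0.\<close>

primrec tensor_homotopy ::
  "(('w \<Rightarrow>\<^sub>0 'k::field) \<Rightarrow> ('w \<Rightarrow>\<^sub>0 'k)) \<Rightarrow> (('w \<Rightarrow>\<^sub>0 'k) \<Rightarrow> ('w \<Rightarrow>\<^sub>0 'k)) \<Rightarrow> 'w list \<Rightarrow> ('w list \<Rightarrow>\<^sub>0 'k)" where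
  "tensor_homotopy h p [] = 0"
| "tensor_homotopy h p (w # ws) = h (bas w) \<otimes> bas ws + p (bas w) \<otimes> tensor_homotopy h p ws"

primrec tensor_proj :: "(('w \<Rightarrow>\<^sub>0 'k::field) \<Rightarrow> ('w \<Rightarrow>\<^sub>0 'k)) \<Rightarrow> 'w list \<Rightarrow> ('w list \<Rightarrow>\<^sub>0 'k)" where
  "tensor_proj p [] = bas []"
| "tensor_proj p (w # ws) = p (bas w) \<otimes> tensor_proj p ws"

lemma tensor_homotopy_ten:
  assumes "lin h" "lin p"
  shows "lin_ext (tensor_homotopy h p) (r \<otimes> t) = h r \<otimes> t + p r \<otimes> lin_ext (tensor_homotopy h p) t"
proof (rule bilin_eq_on[of "\<lambda>r t. lin_ext (tensor_homotopy h p) (r \<otimes> t)" _ UNIV UNIV])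
  show "bilin (\<lambda>r t. lin_ext (tensor_homotopy h p) (r \<otimes> t))"
    "bilin (\<lambda>r t. h r \<otimes> t + p r \<otimes> lin_ext (tensor_homotopy h p) t)"
    by (intro bilinI lin_comp[OF lin_lin_ext] lin_plus bilin_lin1[OF bilin_ten]
        bilin_lin2[OF bilin_ten] lin_lin_ext lin_id assms)+
qed (auto simp: kspan_def)

text \<open>The form in which the quasi-isomorphism enters: a cycle of positive degree is a
  boundary. Boundaries in degree 0 of the tensor power come from assumption (ii) instead.\<close>

locale acyclic_dg = linear_dg V F d for V F and d :: "(('o, 'g) word \<Rightarrow>\<^sub>0 'k::field_char_0) \<Rightarrow> _" +
  assumes coloured: "coloured_by V F"
    and acyclic: "a \<in> V \<Longrightarrow> b \<in> V \<Longrightarrow> z \<in> kspan (homog V F b a (Suc i)) \<Longrightarrow> d z = 0 \<Longrightarrow>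
      \<exists>y \<in> kspan (homog V F b a (Suc (Suc i))). d y = z"
begin

text \<open>
  With \<open>s\<^sub>i\<close> a linear right inverse of \<open>d\<close> on the boundaries of degree \<open>i\<close>, the homotopy is
  \<open>s\<^sub>i (1 - s\<^sub>i\<^sub>-\<^sub>1 d)\<close> in degree \<open>i > 0\<close>, as \<open>1 - s\<^sub>i\<^sub>-\<^sub>1 d\<close> has values in cycles; in degree 0 the projection
  onto the boundaries is \<open>d s\<^sub>0\<close>.
\<close>

lemma contraction:
  assumes "a \<in> V" "b \<in> V"
  obtains h p where "lin h" "lin p"
    "\<And>i z. z \<in> H b a i \<Longrightarrow> h z \<in> H b a (Suc i)"
    "\<And>i z. z \<in> H b a i \<Longrightarrow> p z \<in> H b a i"
    "\<And>i z. z \<in> H b a (Suc i) \<Longrightarrow> p z = 0"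
    "\<And>i z. z \<in> H b a i \<Longrightarrow> d (h z) + h (d z) = z - p z"
    "\<And>i z. z \<in> H b a i \<Longrightarrow> p (d z) = 0"
proof -
  have "\<exists>s. range s \<subseteq> H b a (Suc i) \<and> lin s \<and> (\<forall>v\<in>d ` H b a (Suc i). d (s v) = v)" for i
    using pm.linear_exists_right_inverse_on[OF _ kspan_subspace] lin_d unfolding lin_iff_linear by blast
  then obtain s where s: "\<And>i z. s i z \<in> H b a (Suc i)" "\<And>i. lin (s i)"
    "\<And>i z. z \<in> H b a (Suc i) \<Longrightarrow> d (s i (d z)) = d z"
    unfolding image_subset_iff by (metis imageI UNIV_I)
  define h where "h = lin_ext (\<lambda>w. case word_deg F w of 0 \<Rightarrow> s 0 (d (s 0 (bas w)))
    | Suc i \<Rightarrow> s (Suc i) (bas w - s i (d (bas w))))"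
  \<comment> \<open>In degree 0 this projects along the boundaries onto a complement, a copy of the
    homology. The identities p d = 0 and d p = 0 are what allows the contraction to pass to tensor
    powers.\<close>
  define p where "p = lin_ext (\<lambda>w. if word_deg F w = 0 then bas w - d (s 0 (bas w)) else 0)"
  have lin: "lin h" "lin p"
    by (simp_all add: h_def p_def lin_lin_ext)
  have h0: "h z = s 0 (d (s 0 z))" if "z \<in> H b a 0" for z
    by (rule lin_eq_on[OF lin(1) lin_comp[OF s(2) lin_comp[OF lin_d s(2)]] _ that])
      (simp add: h_def homogD)
  have hS: "h z = s (Suc i) (z - s i (d z))" if "z \<in> H b a (Suc i)" for z i
    by (rule lin_eq_on[OF lin(1) lin_comp[OF s(2) lin_minus[OF lin_id lin_comp[OF s(2) lin_d]]] _ that])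
      (simp add: h_def homogD)
  have p0: "p z = z - d (s 0 z)" if "z \<in> H b a 0" for z
    by (rule lin_eq_on[OF lin(2) lin_minus[OF lin_id lin_comp[OF lin_d s(2)]] _ that])
      (simp add: p_def homogD)
  have pS: "p z = 0" if "z \<in> H b a (Suc i)" for z i
    by (rule lin_eq_on[OF lin(2) lin_zero _ that]) (simp add: p_def homogD)
  have pH: "p z \<in> H b a i" if "z \<in> H b a i" for z i
  proof (cases i)
    case 0
    then show ?thesis using that d_H_Suc[OF s(1)] by (auto simp: p0)
  qed (use that pS in auto)
  have hH: "h z \<in> H b a (Suc i)" if "z \<in> H b a i" for z i
    using that s(1) by (cases i) (auto simp: h0 hS)
  have pd: "p (d z) = 0" if "z \<in> H b a i" for z i
  proof (cases i)
    case 0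
    then show ?thesis using that by (simp add: d_H_0 lin_0[OF lin(2)])
  next
    case (Suc j)
    then have dz: "z \<in> H b a (Suc j)" "d z \<in> H b a j"
      using that d_H_Suc by auto
    then show ?thesis
      using s(3) by (cases j) (auto simp: p0 pS)
  qed
  have hom: "d (h z) + h (d z) = z - p z" if "z \<in> H b a i" for z i
  proof (cases i)
    case 0
    then show ?thesis
      using that s(1,3) by (simp add: d_H_0 lin_0[OF lin(1)] h0 p0)
  next
    case (Suc j)
    then have z: "z \<in> H b a (Suc j)" and dz: "d z \<in> H b a j"
      using that d_H_Suc by auto
    \<comment> \<open>Subtracting \<open>s j (d z)\<close> makes \<open>z\<close> a cycle; by
      acyclicity it is then a boundary, and on boundaries \<open>s\<close> is a section of
      \<open>d\<close>.\<close>
    let ?c = "z - s j (d z)"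
    have "?c \<in> H b a (Suc j)"
      using z s(1) by auto
    moreover have "d ?c = 0"
      using z s(3) by (simp add: lin_diff[OF lin_d])
    ultimately obtain y where "y \<in> H b a (Suc (Suc j))" "d y = ?c"
      using acyclic[OF assms] by blast
    then have 1: "d (h z) = ?c"
      using s(3)[of y "Suc j"] by (simp add: hS[OF z])
    \<comment> \<open>For j = 0 the projection \<open>d (s 0 _)\<close> fixes the boundary
      \<open>d z\<close>; for j > 0 the correction term of \<open>h\<close> drops out because d d =
      0.\<close>
    have "h (d z) = s j (d z)"
    proof (cases j)
      case 0
      then show ?thesis using dz z s(3) by (auto simp: h0)
    next
      case (Suc l)
      then show ?thesis
        using dz z by (auto simp: hS d_d_H lin_0[OF s(2)])
    qed
    with 1 z show ?thesis by (simp add: pS)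
  qed
  show thesis
    by (rule that[OF lin hH pH pS hom pd])
qed

text \<open>The homotopy K satisfies \<partial>K + K\<partial> = 1 - p \<otimes> ... \<otimes> p. In
  positive total degree some factor has positive degree, so the product of the p vanishes and K z
  has boundary z for every cycle z.\<close>

lemma tensor_acyclic:
  assumes "a \<in> V" "b \<in> V" and z: "z \<in> TH n b a (Suc i)" "\<partial> z = 0"
  obtains y where "y \<in> TH n b a (Suc (Suc i))" "\<partial> y = z"
proof -
  from contraction[OF assms(1,2)] obtain h p where lin: "lin h" "lin p"
    and hH: "\<And>i z. z \<in> H b a i \<Longrightarrow> h z \<in> H b a (Suc i)"
    and pH: "\<And>i z. z \<in> H b a i \<Longrightarrow> p z \<in> H b a i"
    and pS: "\<And>i z. z \<in> H b a (Suc i) \<Longrightarrow> p z = 0"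
    and hom: "\<And>i z. z \<in> H b a i \<Longrightarrow> d (h z) + h (d z) = z - p z"
    and pd: "\<And>i z. z \<in> H b a i \<Longrightarrow> p (d z) = 0"
    by blast
  define K where "K = lin_ext (tensor_homotopy h p)"
  have linK: "lin K"
    by (simp add: K_def lin_lin_ext)
  have K_ten: "K (r \<otimes> t) = h r \<otimes> t + p r \<otimes> K t" for r t
    unfolding K_def by (rule tensor_homotopy_ten[OF lin])
  have K: "K (bas ws) \<in> TH n b a (Suc i) \<and> \<partial> (K (bas ws)) + K (\<partial> (bas ws)) = bas ws - tensor_proj p ws
      \<and> (0 < i \<longrightarrow> tensor_proj p ws = 0)" if "ws \<in> thomog V F n b a i" for n ws i
    using that
  proof (induction n arbitrary: ws i)
    case 0
    then show ?case
      by (auto simp: thomog_0 K_def linear_simps lin_0[OF lin_lin_ext] split: if_splits)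
  next
    case (Suc n)
    then obtain w vs j k where ws: "ws = w # vs" "i = j + k" "w \<in> homog V F b a j" "vs \<in> thomog V F n b a k"
      by (elim thomog_SucE)
    then have bas: "bas w \<in> H b a j" "bas vs \<in> TH n b a k"
      by auto
    note IH = Suc.IH[OF ws(4)]
    have K_ws: "K (bas ws) = h (bas w) \<otimes> bas vs + p (bas w) \<otimes> K (bas vs)"
      unfolding ws(1) ten_bas[symmetric] by (rule K_ten)
    have "h (bas w) \<otimes> bas vs \<in> TH (Suc n) b a (Suc j + k)"
      by (rule ten_in_thomog) (use hH bas in auto)
    moreover have "p (bas w) \<otimes> K (bas vs) \<in> TH (Suc n) b a (j + Suc k)"
      by (rule ten_in_thomog) (use pH bas IH in auto)
    ultimately have 1: "K (bas ws) \<in> TH (Suc n) b a (Suc i)"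
      by (simp add: K_ws ws(2) kspan_add)
    \<comment> \<open>A term containing \<open>p (bas w)\<close> survives only for j = 0 and so
      carries no sign. The two terms h (bas w) \<otimes> \<partial> (bas vs) cancel, since h raises
      the degree by one.\<close>
    have dp: "d (p (bas w)) = 0" and sign: "p (bas w) = 0 \<or> j = 0"
      using pH[OF bas(1)] pS[of "bas w"] bas(1) d_H_0 by (cases j; auto simp: lin_0[OF lin_d])+
    have "\<partial> (K (bas ws)) = d (h (bas w)) \<otimes> bas vs - smul ((-1) ^ j) (h (bas w) \<otimes> \<partial> (bas vs))
        + p (bas w) \<otimes> \<partial> (K (bas vs))"
      using sign by (auto simp: K_ws linear_simps diff_ten[OF hH[OF bas(1)]] diff_ten[OF pH[OF bas(1)]] dp)
    moreover have "K (\<partial> (bas ws)) = h (d (bas w)) \<otimes> bas vs + smul ((-1) ^ j) (h (bas w) \<otimes> \<partial> (bas vs))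
        + p (bas w) \<otimes> K (\<partial> (bas vs))"
      using sign by (auto simp: ws(1) tensor_diff_Cons homogD(1)[OF ws(3)] lin_add[OF linK] lin_smul[OF linK] K_ten
          pd[OF bas(1)] linear_simps pm.scale_right_distrib)
    ultimately have "\<partial> (K (bas ws)) + K (\<partial> (bas ws)) =
        (d (h (bas w)) + h (d (bas w))) \<otimes> bas vs + p (bas w) \<otimes> (\<partial> (K (bas vs)) + K (\<partial> (bas vs)))"
      by (simp add: linear_simps)
    also have "\<dots> = bas ws - tensor_proj p ws"
      using IH by (simp add: hom[OF bas(1)] ws(1) linear_simps)
    finally have 2: "\<partial> (K (bas ws)) + K (\<partial> (bas ws)) = bas ws - tensor_proj p ws" .
    have "tensor_proj p ws = 0" if "0 < i"
      using that sign IH by (auto simp: ws(1,2) linear_simps)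
    with 1 2 show ?case by blast
  qed
  have "\<partial> (K z) + K (\<partial> z) = z"
    by (rule lin_eq_on[OF lin_plus[OF lin_comp[OF lin_tensor_diff linK] lin_comp[OF linK lin_tensor_diff]]
          lin_id _ z(1)]) (use K[of _ n "Suc i"] in simp)
  moreover have "K z \<in> TH n b a (Suc (Suc i))"
    by (rule lin_into[OF linK _ z(1)]) (use K in blast)
  ultimately show thesis
    using that z(2) by (simp add: lin_0[OF linK])
qed

text \<open>The telescoping sum in recursive form: either \<open>r\<close> stands in front of a
  power of \<open>r1\<close>, or \<open>r2\<close> stands in front of the path for one factor less.
  Since \<open>r2\<close> has degree 0, no signs arise.\<close>

lemma path_of_powers:
  assumes "r \<in> H b a (Suc 0)" "r1 \<in> homog V F b a 0" "r2 \<in> homog V F b a 0" "d r = bas r1 - bas r2"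
  shows "\<exists>y \<in> TH n b a (Suc 0). \<partial> y = bas (replicate n r1) - bas (replicate n r2)"
proof (induction n)
  case (Suc n)
  then obtain y where y: "y \<in> TH n b a (Suc 0)" "\<partial> y = bas (replicate n r1) - bas (replicate n r2)"
    by blast
  have rep: "bas (replicate n r1) \<in> TH n b a 0"
    using assms(2) by (auto simp: thomog_def homog_def sum_list_replicate)
  let ?y = "r \<otimes> bas (replicate n r1) + bas r2 \<otimes> y"
  have r2: "bas r2 \<in> H b a 0" using assms(3) by simp
  have "?y \<in> TH (Suc n) b a (Suc 0)"
    using ten_in_thomog[OF assms(1) rep] ten_in_thomog[OF r2 y(1)] by auto
  moreover have "\<partial> ?y = bas (replicate (Suc n) r1) - bas (replicate (Suc n) r2)"
    by (simp add: linear_simps diff_ten[OF assms(1)] diff_ten[OF r2] d_H_0[OF r2] diff_TH_0[OF rep]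
        assms(4) y(2))
  ultimately show ?case by blast
qed (auto intro: bexI[of _ 0] simp: linear_simps)

end

section \<open>Construction on generators\<close>

text \<open>The extension by composition of a prescription \<open>G\<close> on generators. It takes
  \<open>G\<close> as a parameter because during the recursion only the values in lower degrees are
  known.\<close>

primrec diag_list ::
  "('o, 'g) coloured_basis \<Rightarrow> nat \<Rightarrow> ('g \<Rightarrow> (('o, 'g) word list \<Rightarrow>\<^sub>0 'k::field)) \<Rightarrow> 'o \<Rightarrow> 'g list \<Rightarrow>
   (('o, 'g) word list \<Rightarrow>\<^sub>0 'k)" where
  "diag_list F n G a [] = bas (replicate n ([], a))"
| "diag_list F n G a (g # gs) = tensor_comp F n (G g) (diag_list F n G a gs)"

definition diag ::
  "('o, 'g) coloured_basis \<Rightarrow> nat \<Rightarrow> ('g \<Rightarrow> (('o, 'g) word list \<Rightarrow>\<^sub>0 'k::field)) \<Rightarrow>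
   (('o, 'g) word \<Rightarrow>\<^sub>0 'k) \<Rightarrow> (('o, 'g) word list \<Rightarrow>\<^sub>0 'k)" where
  "diag F n G = lin_ext (\<lambda>(gs, a). diag_list F n G a gs)"

lemma lin_diag: "lin (diag F n G)"
  by (simp add: diag_def lin_lin_ext)

lemma diag_Nil: "diag F n G (bas ([], a)) = bas (replicate n ([], a))"
  and diag_Cons: "diag F n G (bas (g # gs, a)) = tensor_comp F n (G g) (diag F n G (bas (gs, a)))"
  by (simp_all add: diag_def)

abbreviation gen_word :: "('o, 'g) coloured_basis \<Rightarrow> 'g \<Rightarrow> ('o, 'g) word" where
  "gen_word F g \<equiv> ([g], gin F g)"

lemma homog_Nil: "([], c) \<in> homog V F b a i \<longleftrightarrow> b = c \<and> a = c \<and> c \<in> V \<and> i = 0"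
  by (auto simp: homog_def hom_words_def words_def)

lemma homog_Cons:
  "(g # gs, c) \<in> homog V F b a i \<longleftrightarrow>
    g \<in> gens F \<and> b = gout F g \<and> c = a \<and> (\<exists>j. i = gdeg F g + j \<and> (gs, a) \<in> homog V F (gin F g) a j)"
  by (auto simp: homog_def hom_words_def words_def)

lemma homog_gens:
  assumes "(gs, c) \<in> homog V F b a i" "g \<in> set gs"
  shows "g \<in> gens F \<and> gdeg F g \<le> i"
  using assms by (induction gs arbitrary: b i) (auto simp: homog_Cons, force)

lemma gen_word_homog:
  "coloured_by V F \<Longrightarrow> g \<in> gens F \<Longrightarrow> gen_word F g \<in> homog V F (gout F g) (gin F g) (gdeg F g)"
  by (auto simp: homog_Cons homog_Nil coloured_by_def)

lemma replicate_thomog: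
  "w \<in> homog V F b a 0 \<Longrightarrow> replicate n w \<in> thomog V F n b a 0"
  by (auto simp: thomog_def homog_def sum_list_replicate)

lemma sigma_stable_replicate:
  assumes "word_deg F w = 0"
  shows "sigma_stable F n (bas (replicate n w))"
proof (rule sigma_stableI)
  fix i j assume "i < j" "j < n"
  moreover from this have "(replicate n w)[i := w, j := w] = replicate n w"
    by (intro nth_equalityI) (auto simp: nth_list_update)
  ultimately show "transpose_op F i j (bas (replicate n w)) = bas (replicate n w)"
    using assms by (simp add: transpose_op_bas)
qed

lemma tensor_comp_replicate:
  assumes "word_deg F u = 0" "word_deg F w = 0" "word_in u = word_out F w"
  shows "tensor_comp F n (bas (replicate n u)) (bas (replicate n w)) = bas (replicate n (word_comp u w))"
  using assms by (induction n) (simp_all add: tensor_comp_Cons free_comp_bas)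

lemma words_homog: "w \<in> words V F \<Longrightarrow> w \<in> homog V F (word_out F w) (word_in w) (word_deg F w)"
  by (simp add: homog_def hom_words_def)

lemma homog_colours:
  assumes "coloured_by V F" "(gs, c) \<in> homog V F b a i"
  shows "a \<in> V \<and> b \<in> V"
  using assms(2)
proof (induction gs arbitrary: b i)
  case (Cons g gs)
  then show ?case using assms(1) by (auto simp: homog_Cons coloured_by_def)
qed (auto simp: homog_Nil)

section \<open>Solving the conditions on generators by recursion on the degree\<close>

context acyclic_dg
begin

text \<open>The requirements (C1)-(C4) and (C6) at one generator. The candidate \<open>x\<close> is
  separate from \<open>G\<close>: the right-hand side of the boundary equation uses \<open>G\<close>
  only below the degree of \<open>g\<close>, where it has already been chosen.\<close>

definition good :: "nat \<Rightarrow> ('g \<Rightarrow> (('o, 'g) word list \<Rightarrow>\<^sub>0 'k)) \<Rightarrow> 'g \<Rightarrow> (('o, 'g) word list \<Rightarrow>\<^sub>0 'k) \<Rightarrow> bool" where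
  "good n G g x \<longleftrightarrow> x \<in> TH n (gout F g) (gin F g) (gdeg F g) \<and> sigma_stable F n x \<and>
     \<partial> x = diag F n G (d (bas (gen_word F g))) \<and>
     (gdeg F g = 0 \<longrightarrow> x = bas (replicate n (gen_word F g)))"

definition good_below :: "nat \<Rightarrow> ('g \<Rightarrow> (('o, 'g) word list \<Rightarrow>\<^sub>0 'k)) \<Rightarrow> nat \<Rightarrow> bool" where
  "good_below n G m \<longleftrightarrow> (\<forall>g\<in>gens F. gdeg F g < m \<longrightarrow> good n G g (G g))"

lemma diag_word:
  assumes "good_below n G m" "i < m" "w \<in> homog V F b a i"
  shows "diag F n G (bas w) \<in> TH n b a i \<and> sigma_stable F n (diag F n G (bas w))"
proof -
  obtain gs c where w: "w = (gs, c)" by (cases w)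
  have "diag F n G (bas (gs, c)) \<in> TH n b a i \<and> sigma_stable F n (diag F n G (bas (gs, c)))"
    using assms(2,3) unfolding w
  proof (induction gs arbitrary: b i)
    case Nil
    then show ?case
      by (auto simp: homog_Nil diag_Nil intro!: sigma_stable_replicate replicate_thomog)
  next
    case (Cons g gs)
    then obtain j where g: "g \<in> gens F" "b = gout F g" "c = a" "i = gdeg F g + j"
      "(gs, c) \<in> homog V F (gin F g) a j"
      by (auto simp: homog_Cons)
    have "good n G g (G g)"
      using assms(1) g Cons.prems by (simp add: good_below_def)
    then have 1: "G g \<in> TH n (gout F g) (gin F g) (gdeg F g)" "sigma_stable F n (G g)"
      by (auto simp: good_def)
    have 2: "diag F n G (bas (gs, c)) \<in> TH n (gin F g) a j" "sigma_stable F n (diag F n G (bas (gs, c)))"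
      using Cons.IH[OF _ g(5)] Cons.prems g by auto
    show ?case
      unfolding diag_Cons g(2,4)
      using tensor_comp_in_thomog[OF 1(1) 2(1)] sigma_stable_tensor_comp[OF 1(1) 2(1) 1(2) 2(2)] by blast
  qed
  then show ?thesis by (simp add: w)
qed

lemma diag_TH:
  assumes "good_below n G m" "i < m" "r \<in> H b a i"
  shows "diag F n G r \<in> TH n b a i" "sigma_stable F n (diag F n G r)"
  using diag_word[OF assms(1,2)]
  by (auto intro: lin_into[OF lin_diag _ assms(3)] sigma_stable_span[OF assms(3) lin_diag])

lemma diag_degree_0:
  assumes "good_below n G m" "0 < m" "w \<in> homog V F b a 0"
  shows "diag F n G (bas w) = bas (replicate n w)"
proof -
  obtain gs c where w: "w = (gs, c)" by (cases w)
  show ?thesis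
    using assms(3) unfolding w
  proof (induction gs arbitrary: b)
    case (Cons g gs)
    then have g: "g \<in> gens F" "c = a" "gdeg F g = 0" "(gs, c) \<in> homog V F (gin F g) a 0"
      by (auto simp: homog_Cons)
    then have "G g = bas (replicate n (gen_word F g))"
      using assms(1,2) by (auto simp: good_below_def good_def)
    then show ?case
      using Cons.IH[OF g(4)] g homogD(1,3)[OF g(4)] by (simp add: diag_Cons tensor_comp_replicate)
  qed (simp add: diag_Nil)
qed

text \<open>The bound \<open>m\<close> concerns the degrees of \<open>u\<close> and
  \<open>w\<close>, not that of the composite: what counts is that their letters have good
  values.\<close>

lemma diag_word_comp:
  assumes "good_below n G m" "i < m" "j < m" "u \<in> homog V F c b i" "w \<in> homog V F b a j"
  shows "diag F n G (bas (word_comp u w)) = tensor_comp F n (diag F n G (bas u)) (diag F n G (bas w))"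
proof -
  obtain gs b' where u: "u = (gs, b')" by (cases u)
  obtain hs a' where w: "w = (hs, a')" by (cases w)
  have Dw: "diag F n G (bas w) \<in> TH n b a j"
    using diag_word assms by blast
  show ?thesis
    using assms(2,4) unfolding u
  proof (induction gs arbitrary: c i)
    case Nil
    then show ?case
      using Dw by (auto simp: homog_Nil diag_Nil tensor_comp_unit_left w)
  next
    case (Cons g gs)
    then obtain k where g: "g \<in> gens F" "b' = b" "i = gdeg F g + k"
      "(gs, b) \<in> homog V F (gin F g) b k"
      by (auto simp: homog_Cons)
    have "good n G g (G g)"
      using assms(1) g Cons.prems by (simp add: good_below_def)
    then have 1: "G g \<in> TH n (gout F g) (gin F g) (gdeg F g)"
      by (simp add: good_def)
    have 2: "diag F n G (bas (gs, b)) \<in> TH n (gin F g) b k"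
      using diag_word[OF assms(1) _ g(4)] Cons.prems g by simp
    have "diag F n G (bas (word_comp (gs, b) w)) =
      tensor_comp F n (diag F n G (bas (gs, b))) (diag F n G (bas w))"
      using Cons.IH[of k "gin F g"] Cons.prems g by simp
    then show ?case
      using tensor_comp_assoc[OF 1 2 Dw] g(2) by (simp add: w diag_Cons)
  qed
qed

lemma diag_free_comp:
  assumes "good_below n G m" "i < m" "j < m" "r \<in> H c b i" "s \<in> H b a j"
  shows "diag F n G (free_comp F r s) = tensor_comp F n (diag F n G r) (diag F n G s)"
proof (rule bilin_eq_on[OF _ _ _ assms(4,5), of "\<lambda>r s. diag F n G (free_comp F r s)"])
  show "bilin (\<lambda>r s. diag F n G (free_comp F r s))"
    "bilin (\<lambda>r s. tensor_comp F n (diag F n G r) (diag F n G s))"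
    by (intro bilinI lin_comp[OF lin_diag] bilin_lin1[OF bilin_free_comp] bilin_lin1[OF bilin_tensor_comp]
        bilin_lin2[OF bilin_free_comp] bilin_lin2[OF bilin_tensor_comp] lin_diag lin_id)+
  show "diag F n G (free_comp F (bas u) (bas w)) = tensor_comp F n (diag F n G (bas u)) (diag F n G (bas w))"
    if "u \<in> homog V F c b i" "w \<in> homog V F b a j" for u w
    using that diag_word_comp[OF assms(1-3) that] by (simp add: free_comp_bas homogD)
qed

text \<open>Treats a letter on the left directly by the recursive clause of
  \<open>diag_list\<close>, avoiding the value of \<open>diag\<close> at the one-letter word, which
  is \<open>G g\<close> composed with units.\<close>

lemma diag_gen_comp:
  assumes "s \<in> H (gin F g) a j"
  shows "diag F n G (free_comp F (bas (gen_word F g)) s) = tensor_comp F n (G g) (diag F n G s)"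
proof (rule lin_eq_on[OF _ _ _ assms])
  show "diag F n G (free_comp F (bas (gen_word F g)) (bas w)) = tensor_comp F n (G g) (diag F n G (bas w))"
    if "w \<in> homog V F (gin F g) a j" for w
    using homogD(3)[OF that] by (cases w) (simp add: free_comp_bas diag_Cons)
qed (rule lin_comp[OF lin_diag bilin_lin2[OF bilin_free_comp lin_id]],
    rule bilin_lin2[OF bilin_tensor_comp lin_diag])

text \<open>Split off the first letter and expand both sides by the Leibniz rules of the tensor
  power and of the operad. The terms agree by the boundary equation for the letter and the induction
  hypothesis for the remaining word.\<close>

lemma diff_diag_word:
  assumes "good_below n G m" "i < m" "w \<in> homog V F b a i"
  shows "\<partial> (diag F n G (bas w)) = diag F n G (d (bas w))"
proof -
  obtain gs c where w: "w = (gs, c)" by (cases w)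
  show ?thesis
    using assms(2,3) unfolding w
  proof (induction gs arbitrary: b i)
    case Nil
    then have "([], c) \<in> homog V F c c 0"
      by (auto simp: homog_Nil)
    then show ?case
      using diff_TH_0[of "bas (replicate n ([], c))" n c c] replicate_thomog[of "([], c)" V F c c n]
      by (simp add: diag_Nil d_0 lin_0[OF lin_diag])
  next
    case (Cons g gs)
    then obtain j where g: "g \<in> gens F" "c = a" "b = gout F g" "i = gdeg F g + j"
      "(gs, a) \<in> homog V F (gin F g) a j"
      by (auto simp: homog_Cons)
    let ?D = "diag F n G" and ?g = "bas (gen_word F g) :: _ \<Rightarrow>\<^sub>0 'k" and ?w = "bas (gs, a) :: _ \<Rightarrow>\<^sub>0 'k"
    have good: "good n G g (G g)"
      using assms(1) g Cons.prems by (simp add: good_below_def)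
    have gw: "gen_word F g \<in> homog V F (gout F g) (gin F g) (gdeg F g)"
      by (rule gen_word_homog[OF coloured g(1)])
    have w: "?w \<in> H (gin F g) a j" using g by simp
    have "\<partial> (?D (bas (g # gs, c))) = \<partial> (tensor_comp F n (G g) (?D ?w))"
      by (simp add: diag_Cons g(2))
    also have "\<dots> = tensor_comp F n (\<partial> (G g)) (?D ?w) + smul ((-1) ^ gdeg F g) (tensor_comp F n (G g) (\<partial> (?D ?w)))"
      by (rule diff_tensor_comp[OF _ diag_TH(1)[OF assms(1) _ w]])
        (use good g Cons.prems in \<open>auto simp: good_def\<close>)
    also have "\<partial> (G g) = ?D (d ?g)"
      using good by (simp add: good_def)
    also have "\<partial> (?D ?w) = ?D (d ?w)"
      using Cons.IH[of j "gin F g"] Cons.prems g by simp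
    also have "tensor_comp F n (?D (d ?g)) (?D ?w) = ?D (free_comp F (d ?g) ?w)"
      by (rule diag_free_comp[OF assms(1) _ _ d_H w, symmetric]) (use gw g Cons.prems in auto)
    also have "tensor_comp F n (G g) (?D (d ?w)) = ?D (free_comp F ?g (d ?w))"
      by (rule diag_gen_comp[OF d_H[OF w], symmetric])
    finally have "\<partial> (?D (bas (g # gs, c))) =
        ?D (free_comp F (d ?g) ?w + smul ((-1) ^ gdeg F g) (free_comp F ?g (d ?w)))"
      by (simp add: lin_add[OF lin_diag] lin_smul[OF lin_diag])
    then show ?case
      using leibniz[OF gw g(5)] g(2) by simp
  qed
qed

lemma diff_diag:
  assumes "good_below n G m" "i < m" "r \<in> H b a i"
  shows "\<partial> (diag F n G r) = diag F n G (d r)"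
  by (rule lin_eq_on[OF lin_comp[OF lin_tensor_diff lin_diag] lin_comp[OF lin_diag lin_d] _ assms(3)])
    (rule diff_diag_word[OF assms(1,2)])

lemma good_extend:
  assumes deg1: "gdeg F g = 1 \<Longrightarrow> \<exists>r1\<in>words V F. \<exists>r2\<in>words V F. word_deg F r1 = 0 \<and> word_deg F r2 = 0 \<and>
      d (bas (gen_word F g)) = bas r1 - bas r2"
    and g: "g \<in> gens F" and good: "good_below n G (gdeg F g)"
  shows "\<exists>x. good n G g x"
proof -
  let ?a = "gin F g" and ?b = "gout F g" and ?g = "bas (gen_word F g) :: _ \<Rightarrow>\<^sub>0 'k"
  have gw: "gen_word F g \<in> homog V F ?b ?a (gdeg F g)"
    by (rule gen_word_homog[OF coloured g])
  have colours: "?a \<in> V" "?b \<in> V"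
    using coloured g by (auto simp: coloured_by_def)
  show ?thesis
  proof (cases "gdeg F g")
    case 0
    with gw have gw0: "gen_word F g \<in> homog V F ?b ?a 0" by simp
    let ?x = "bas (replicate n (gen_word F g)) :: _ \<Rightarrow>\<^sub>0 'k"
    have "?x \<in> TH n ?b ?a 0"
      using replicate_thomog[OF gw0] by simp
    moreover from this have "\<partial> ?x = 0"
      by (rule diff_TH_0)
    moreover have "sigma_stable F n ?x"
      by (rule sigma_stable_replicate) (use 0 in simp)
    ultimately have "good n G g ?x"
      using 0 d_0[OF gw0] by (simp add: good_def lin_0[OF lin_diag])
    then show ?thesis by blast
  next
    case (Suc m)
    then have dg: "d ?g \<in> H ?b ?a m"
      using gw d_Suc by simp
    define z where "z = diag F n G (d ?g)"
    have z: "z \<in> TH n ?b ?a m" "sigma_stable F n z" "\<partial> z = 0"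
      using diag_TH[OF good _ dg] diff_diag[OF good _ dg] gw Suc
      by (simp_all add: z_def d_d[OF gw] lin_0[OF lin_diag])
    have "\<exists>y \<in> TH n ?b ?a (Suc m). \<partial> y = z"
    proof (cases m)
      case 0
      with deg1 Suc obtain r1 r2 where r: "r1 \<in> words V F" "r2 \<in> words V F"
        "word_deg F r1 = 0" "word_deg F r2 = 0" "d ?g = bas r1 - bas r2"
        by auto
      show ?thesis
      \<comment> \<open>The colours of \<open>r1\<close> and \<open>r2\<close> are not part of
        assumption (ii). If the words differ, both occur in \<open>d ?g\<close> with nonzero
        coefficient and so have the colours of \<open>g\<close>; if they coincide, there is nothing
        to bound.\<close>
      proof (cases "r1 = r2")
        case True
        then have "z = 0" by (simp add: z_def r lin_0[OF lin_diag])
        then show ?thesis by (intro bexI[of _ 0]) (simp_all add: linear_simps)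
      next
        case False
        then have "Poly_Mapping.lookup (d ?g) r1 \<noteq> 0" "Poly_Mapping.lookup (d ?g) r2 \<noteq> 0"
          by (simp_all add: r(5) lookup_minus lookup_single)
        then have r12: "r1 \<in> homog V F ?b ?a 0" "r2 \<in> homog V F ?b ?a 0"
          using dg 0 unfolding kspan_def mem_Collect_eq in_keys_iff[symmetric] by blast+
        then have "z = bas (replicate n r1) - bas (replicate n r2)"
          using diag_degree_0[OF good] Suc by (simp add: z_def r(5) lin_diff[OF lin_diag])
        then show ?thesis
          using path_of_powers[OF _ r12 r(5), of n] gw Suc 0 by simp
      qed
    next
      case (Suc k)
      then show ?thesis
        using tensor_acyclic[OF colours, of z n k] z by metis
    qed
    then obtain y where "y \<in> TH n ?b ?a (Suc m)" "\<partial> y = z" by blast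
    then obtain x where "x \<in> TH n ?b ?a (Suc m)" "sigma_stable F n x" "\<partial> x = z"
      using symmetrise z(2) by metis
    then have "good n G g x"
      using Suc by (simp add: good_def z_def)
    then show ?thesis by blast
  qed
qed

text \<open>Makes the recursion well founded: a word of degree m has only letters of degree at most
  m, so the differential of a generator involves only generators of smaller degree.\<close>

lemma diag_cong:
  assumes "\<And>h. gdeg F h < gdeg F g \<Longrightarrow> G h = G' h" "g \<in> gens F"
  shows "diag F n G (d (bas (gen_word F g))) = diag F n G' (d (bas (gen_word F g)))"
proof -
  have gw: "gen_word F g \<in> homog V F (gout F g) (gin F g) (gdeg F g)"
    by (rule gen_word_homog[OF coloured assms(2)])
  show ?thesis
  proof (cases "gdeg F g")
    case 0
    with gw show ?thesis by (simp add: d_0 lin_0[OF lin_diag])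
  next
    case (Suc m)
    have list: "diag_list F n G c gs = diag_list F n G' c gs" if "\<forall>h\<in>set gs. gdeg F h \<le> m" for c gs
      using that Suc assms(1) by (induction gs) simp_all
    have "d (bas (gen_word F g)) \<in> H (gout F g) (gin F g) m"
      using gw Suc d_Suc by simp
    then show ?thesis
    proof (rule lin_eq_on[OF lin_diag lin_diag, rotated])
      fix w assume "w \<in> homog V F (gout F g) (gin F g) m"
      then show "diag F n G (bas w) = diag F n G' (bas w)"
        using homog_gens by (cases w) (force simp: diag_def intro: list)
    qed
  qed
qed

lemma good_exists:
  assumes "\<And>g. g \<in> gens F \<Longrightarrow> gdeg F g = 1 \<Longrightarrow>
      \<exists>r1\<in>words V F. \<exists>r2\<in>words V F. word_deg F r1 = 0 \<and> word_deg F r2 = 0 \<and>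
        d (bas (gen_word F g)) = bas r1 - bas r2"
  obtains G where "\<And>m. good_below n G m"
proof -
  have "\<exists>G. \<forall>g. g \<in> gens F \<longrightarrow> good n G g (G g)"
  \<comment> \<open>The value at \<open>g\<close> is an arbitrary solution of a condition that
    depends on the choices made in lower degrees, whence dependent choice along the degree.\<close>
  proof (rule dependent_wf_choice[of "Wellfounded.measure (gdeg F)"])
    show "(g \<in> gens F \<longrightarrow> good n G g x) = (g \<in> gens F \<longrightarrow> good n G' g x)"
      if "\<And>h. (h, g) \<in> Wellfounded.measure (gdeg F) \<Longrightarrow> G h = G' h" for G G' g x
      using diag_cong[of g G G'] that by (auto simp: good_def)
    show "\<exists>x. g \<in> gens F \<longrightarrow> good n G g x"
      if "\<And>h. (h, g) \<in> Wellfounded.measure (gdeg F) \<Longrightarrow> h \<in> gens F \<longrightarrow> good n G h (G h)" for G g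
      using good_extend[of g n G] assms that by (auto simp: good_below_def)
  qed simp
  then show thesis
    using that by (auto simp: good_below_def)
qed

end

section \<open>From the given resolution to an everywhere linear differential\<close>

lemma tensor_diff_lin_ext: "tensor_diff F (lin_ext (\<lambda>w. d (bas w))) = tensor_diff F d"
  by (simp add: tensor_diff_def)

lemma lin_ext_klinear:
  assumes "klinear (kspan S) B f" "p \<in> kspan S"
  shows "lin_ext (\<lambda>w. f (bas w)) p = f p"
proof -
  have f0: "f 0 = 0"
    using assms(1) unfolding klinear_def by (metis add_cancel_right_left kspan_0)
  have "p \<in> kspan S \<and> lin_ext (\<lambda>w. f (bas w)) p = f p"
    using assms(2)
    by (induction rule: kspan_induct)
      (use assms(1) f0 in \<open>auto simp: klinear_def lin_0[OF lin_lin_ext] lin_add[OF lin_lin_ext]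
          lin_smul[OF lin_lin_ext]\<close>)
  then show ?thesis ..
qed

lemma free_complex_homog: "free_complex V F b a i = kspan (homog V F b a i)"
  by (simp add: free_complex_def free_hom_def free_deg_def kspan_Int homog_def deg_words_def hom_words_def)
    (rule arg_cong[where f = kspan], auto)

text \<open>
  The given differential is only linear on the span of the words; the extension of its values on
  words is linear everywhere.
\<close>

lemma free_resolution_acyclic_dg:
  fixes d :: "(('o, 'g) word \<Rightarrow>\<^sub>0 'k::field_char_0) \<Rightarrow> (('o, 'g) word \<Rightarrow>\<^sub>0 'k)"
  assumes "free_resolution C F d \<pi>"
  shows "acyclic_dg (obs C) F (lin_ext (\<lambda>w. d (bas w)))"
proof -
  interpret free_resolution C F d \<pi> by (rule assms)
  let ?V = "obs C" and ?d = "lin_ext (\<lambda>w. d (bas w))"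
  have H_free: "r \<in> free_operad ?V F" "r \<in> free_hom ?V F b a" "r \<in> free_deg ?V F i"
    if "r \<in> kspan (homog ?V F b a i)" for r :: "_ \<Rightarrow>\<^sub>0 'k" and a b i
    using that unfolding free_operad_def free_hom_def free_deg_def
    by (auto simp: kspan_def homog_def hom_words_def deg_words_def)
  have d: "?d r = d r" if "r \<in> kspan (homog ?V F b a i)" for r a b i
    using lin_ext_klinear[of "words ?V F" _ d r] H_free(1)[OF that] d_linear by (simp add: free_operad_def)
  have colours: "a \<in> ?V" "b \<in> ?V" if "w \<in> homog ?V F b a i" for w a b i
    using homog_colours[OF coloured, of "fst w" "snd w" b a i] that by auto
  have d_Suc: "d (bas w) \<in> kspan (homog ?V F b a i)" if "w \<in> homog ?V F b a (Suc i)" for w a b i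
  proof -
    have w: "bas w \<in> kspan (homog ?V F b a (Suc i))"
      using that by simp
    have "d (bas w) \<in> free_complex ?V F b a i"
      unfolding free_complex_def
      using d_colours[OF colours[OF that] H_free(2)[OF w]] d_degree[OF H_free(3)[OF w]] by blast
    then show ?thesis by (simp add: free_complex_homog)
  qed
  have d_0: "d (bas w) = 0" if "w \<in> homog ?V F b a 0" for w a b
    by (rule d_degree_0, rule H_free) (use that in simp)
  show ?thesis
  proof
    show "lin ?d" by (rule lin_lin_ext)
    show "?d (bas w) \<in> kspan (homog ?V F b a i)" if "w \<in> homog ?V F b a (Suc i)" for w b a i
      using d_Suc[OF that] by simp
    show "?d (bas w) = 0" if "w \<in> homog ?V F b a 0" for w b a
      using d_0[OF that] by simp
    show "?d (?d (bas w)) = 0" if "w \<in> homog ?V F b a i" for w b a i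
    proof (cases i)
      case 0
      then show ?thesis using that d_0 by (simp add: lin_0[OF lin_lin_ext])
    next
      case (Suc j)
      then have "?d (d (bas w)) = d (d (bas w))"
        using that by (intro d[OF d_Suc]) simp
      also have "\<dots> = 0"
        by (rule d_square, rule H_free[of _ b a i]) (use that in simp)
      finally show ?thesis by simp
    qed
    show "?d (bas (word_comp u w)) = free_comp F (?d (bas u)) (bas w) + smul ((-1) ^ i) (free_comp F (bas u) (?d (bas w)))"
      if "u \<in> homog ?V F c b i" "w \<in> homog ?V F b a j" for u w c b a i j
    proof -
      have "d (free_comp F (bas u) (bas w)) =
          free_comp F (d (bas u)) (bas w) + smul ((-1) ^ i) (free_comp F (bas u) (d (bas w)))"
        using that by (intro d_leibniz[OF colours[OF that(2)] colours(2)[OF that(1)]])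
          (auto simp: free_complex_homog intro: H_free(2)[of _ _ _ j])
      then show ?thesis
        using that by (simp add: free_comp_bas homogD)
    qed
    show "coloured_by ?V F" by (rule coloured)
    show "\<exists>y \<in> kspan (homog ?V F b a (Suc (Suc i))). ?d y = z"
      if "a \<in> ?V" "b \<in> ?V" "z \<in> kspan (homog ?V F b a (Suc i))" "?d z = 0" for a b z i
    proof -
      have "d z = 0"
        using that d by simp
      \<comment> \<open>The target complex is zero in positive degrees, so the image of
        \<open>z\<close> is trivially a boundary; injectivity on homology then makes
        \<open>z\<close> a boundary.\<close>
      moreover have "\<pi> z = 0"
        using pi_complex[OF that(1,2), of z "Suc i"] that(3) by (simp add: free_complex_homog cat_complex_def)
      moreover have "0 \<in> boundaries (cat_complex C b a) (\<lambda>_. 0 :: _ \<Rightarrow>\<^sub>0 'k) (Suc i)"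
        by (simp add: boundaries_def cat_complex_def)
      ultimately have "z \<in> boundaries (free_complex ?V F b a) d (Suc i)"
        using pi_quism[OF that(1,2)] that(3) by (auto simp: homology_iso_def cycles_def free_complex_homog)
      then show ?thesis
        using d by (auto simp: boundaries_def free_complex_homog)
    qed
  qed
qed

theorem lemma3p6:
  fixes C :: "('o, 'm) category"
    and F :: "('o, 'g) coloured_basis"
    and d :: "(('o, 'g) word \<Rightarrow>\<^sub>0 'k::field_char_0) \<Rightarrow> (('o, 'g) word \<Rightarrow>\<^sub>0 'k)"
    and \<pi> :: "(('o, 'g) word \<Rightarrow>\<^sub>0 'k) \<Rightarrow> ('m \<Rightarrow>\<^sub>0 'k)"
    and M :: "'m set"
    and \<iota> :: "'m \<Rightarrow> 'g"
    and n :: nat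
  assumes "free_resolution C F d \<pi>"
    and "degree0_assumption C F M \<iota>"
    and "degree1_assumption (obs C) F d M \<iota>"
    and "n \<ge> 1"
  shows "\<exists>D :: (('o, 'g) word \<Rightarrow>\<^sub>0 'k) \<Rightarrow> (('o, 'g) word list \<Rightarrow>\<^sub>0 'k).
    klinear (free_operad (obs C) F) (tensor_power n (words (obs C) F)) D \<and>
    (\<forall>r\<in>free_operad (obs C) F. sigma_stable F n (D r)) \<and>
    (\<forall>a\<in>obs C. \<forall>b\<in>obs C. \<forall>r\<in>free_hom (obs C) F b a.
        D r \<in> tensor_power n (hom_words (obs C) F b a)) \<and>
    (\<forall>i. \<forall>r\<in>free_deg (obs C) F i. D r \<in> tensor_deg (obs C) F n i) \<and>
    (\<forall>f\<in>M. D (gen_elem F (\<iota> f)) = tensor (replicate n (gen_elem F (\<iota> f)))) \<and>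
    (\<forall>a\<in>obs C. \<forall>b\<in>obs C. \<forall>c\<in>obs C.
        \<forall>r\<in>free_hom (obs C) F c b. \<forall>r'\<in>free_hom (obs C) F b a.
          D (free_comp F r r') = tensor_comp F n (D r) (D r')) \<and>
    (\<forall>r\<in>free_operad (obs C) F. tensor_diff F d (D r) = D (d r))"
proof -
  interpret free_resolution C F d \<pi> by (rule assms(1))
  let ?V = "obs C"
  define d' where "d' = lin_ext (\<lambda>w. d (bas w))"
  have d'_bas: "d' (bas w) = d (bas w)" for w
    by (simp add: d'_def)
  have d': "d' r = d r" if "r \<in> free_operad ?V F" for r
    using lin_ext_klinear[of "words ?V F" _ d r] that d_linear by (simp add: d'_def free_operad_def)
  \<comment> \<open>The tensor differential evaluates \<open>d\<close> at basis vectors only, where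
    \<open>d\<close> and \<open>d'\<close> agree, so (C6) may be proved for
    \<open>d'\<close>.\<close>
  have tensor_diff: "tensor_diff F d' = tensor_diff F d"
    unfolding d'_def by (rule tensor_diff_lin_ext)
  interpret dg: acyclic_dg ?V F d'
    unfolding d'_def by (rule free_resolution_acyclic_dg[OF assms(1)])
  have \<iota>: "\<iota> ` M = {g \<in> gens F. gdeg F g = 0}"
    using assms(2) by (simp add: degree0_assumption_def bij_betw_def)
  have deg0: "word_deg F w = 0" if "set (fst w) \<subseteq> \<iota> ` M" for w
    using that unfolding \<iota> by (cases w) auto
  have "\<exists>r1\<in>words ?V F. \<exists>r2\<in>words ?V F. word_deg F r1 = 0 \<and> word_deg F r2 = 0 \<and>
      d' (bas (gen_word F g)) = bas r1 - bas r2" if "g \<in> gens F" "gdeg F g = 1" for g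
  proof -
    have "g \<in> {g \<in> gens F. gdeg F g = 1}"
      using that by simp
    from bspec[OF assms(3)[unfolded degree1_assumption_def] this]
    obtain r1 r2 where r: "r1 \<in> words ?V F" "r2 \<in> words ?V F" "set (fst r1) \<subseteq> \<iota> ` M" "set (fst r2) \<subseteq> \<iota> ` M"
      "d (gen_elem F g) = bas r1 - bas r2"
      by (elim bexE conjE)
    show ?thesis
      using r(5) deg0[OF r(3)] deg0[OF r(4)] unfolding d'_bas gen_elem_def
      by (intro bexI[OF _ r(1)] bexI[OF _ r(2)] conjI)
  qed
  then obtain G where G: "\<And>m. dg.good_below n G m"
    using dg.good_exists[of n] by blast
  let ?D = "diag F n G"
  have word: "?D (bas w) \<in> dg.TH n (word_out F w) (word_in w) (word_deg F w)" "sigma_stable F n (?D (bas w))"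
    if "w \<in> words ?V F" for w
    using dg.diag_word[OF G _ words_homog[OF that], of "Suc (word_deg F w)"] by simp_all
  have TH: "thomog ?V F n b a i \<subseteq> {ws. length ws = n \<and> set ws \<subseteq> hom_words ?V F b a}"
    "thomog ?V F n b a i \<subseteq> {ws. length ws = n \<and> set ws \<subseteq> words ?V F}"
    "thomog ?V F n b a i \<subseteq> {ws. length ws = n \<and> set ws \<subseteq> words ?V F \<and> words_deg F ws = i}" for b a i
    by (auto simp: thomog_def hom_words_def)
  have "?D r \<in> tensor_power n (words ?V F)" if "r \<in> free_operad ?V F" for r
    unfolding tensor_power_def
    by (rule lin_into[OF lin_diag _ that[unfolded free_operad_def]])
      (rule subsetD[OF kspan_mono[OF TH(2)] word(1)])
  then have "klinear (free_operad ?V F) (tensor_power n (words ?V F)) ?D"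
    by (simp add: klinear_def lin_add[OF lin_diag] lin_smul[OF lin_diag])
  moreover have "sigma_stable F n (?D r)" if "r \<in> free_operad ?V F" for r
    by (rule sigma_stable_span[OF that[unfolded free_operad_def] lin_diag word(2)])
  moreover have "?D r \<in> tensor_power n (hom_words ?V F b a)" if "r \<in> free_hom ?V F b a" for r a b
    unfolding tensor_power_def
  proof (rule lin_into[OF lin_diag _ that[unfolded free_hom_def]])
    show "?D (bas w) \<in> kspan {ws. length ws = n \<and> set ws \<subseteq> hom_words ?V F b a}"
      if "w \<in> hom_words ?V F b a" for w
    proof -
      from that have w: "w \<in> words ?V F" "word_out F w = b" "word_in w = a"
        by (simp_all add: hom_words_def)
      show ?thesis
        by (rule subsetD[OF kspan_mono[OF TH(1)] word(1)[OF w(1), unfolded w(2,3)]])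
    qed
  qed
  moreover have "?D r \<in> tensor_deg ?V F n i" if "r \<in> free_deg ?V F i" for r i
    unfolding tensor_deg_def
  proof (rule lin_into[OF lin_diag _ that[unfolded free_deg_def]])
    show "?D (bas w) \<in> kspan {ws. length ws = n \<and> set ws \<subseteq> words ?V F \<and> words_deg F ws = i}"
      if "w \<in> deg_words ?V F i" for w
    proof -
      from that have w: "w \<in> words ?V F" "word_deg F w = i"
        by (simp_all add: deg_words_def)
      show ?thesis
        by (rule subsetD[OF kspan_mono[OF TH(3)] word(1)[OF w(1), unfolded w(2)]])
    qed
  qed
  moreover have "?D (gen_elem F (\<iota> f)) = tensor (replicate n (gen_elem F (\<iota> f)))" if "f \<in> M" for f
  proof -
    have "\<iota> f \<in> gens F" "gdeg F (\<iota> f) = 0"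
      using that \<iota> by auto
    then have "gen_word F (\<iota> f) \<in> homog ?V F (gout F (\<iota> f)) (gin F (\<iota> f)) 0"
      using gen_word_homog[OF coloured] by metis
    then have "?D (gen_elem F (\<iota> f)) = bas (replicate n (gen_word F (\<iota> f)))"
      unfolding gen_elem_def by (rule dg.diag_degree_0[OF G zero_less_one])
    also have "\<dots> = tensor (map bas (replicate n (gen_word F (\<iota> f))))"
      by (rule tensor_map_bas[symmetric])
    finally show ?thesis
      by (simp add: gen_elem_def)
  qed
  \<comment> \<open>Elements of \<open>free_hom\<close> may mix degrees. Bilinearity reduces the
    claim to words, and \<open>G\<close> is good below any bound exceeding both of their
    degrees.\<close>
  moreover have "?D (free_comp F r s) = tensor_comp F n (?D r) (?D s)"
    if "r \<in> free_hom ?V F c b" "s \<in> free_hom ?V F b a" for r s a b c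
  proof (rule bilin_eq_on[of "\<lambda>r s. ?D (free_comp F r s)"])
    show "bilin (\<lambda>r s. ?D (free_comp F r s))" "bilin (\<lambda>r s. tensor_comp F n (?D r) (?D s))"
      by (intro bilinI lin_comp[OF lin_diag] bilin_lin1[OF bilin_free_comp] bilin_lin1[OF bilin_tensor_comp]
          bilin_lin2[OF bilin_free_comp] bilin_lin2[OF bilin_tensor_comp] lin_diag lin_id)+
    show "r \<in> kspan (hom_words ?V F c b)" "s \<in> kspan (hom_words ?V F b a)"
      using that by (simp_all add: free_hom_def)
    fix u w assume "u \<in> hom_words ?V F c b" "w \<in> hom_words ?V F b a"
    then have "bas u \<in> dg.H c b (word_deg F u)" "bas w \<in> dg.H b a (word_deg F w)"
      by (simp_all add: homog_def)
    then show "?D (free_comp F (bas u) (bas w)) = tensor_comp F n (?D (bas u)) (?D (bas w))"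
      by (rule dg.diag_free_comp[OF G less_add_Suc1 less_add_Suc2])
  qed
  moreover have "tensor_diff F d (?D r) = ?D (d r)" if "r \<in> free_operad ?V F" for r
    unfolding d'[OF that, symmetric] tensor_diff[symmetric]
  proof (rule lin_eq_on[OF lin_comp[OF lin_tensor_diff lin_diag] lin_comp[OF lin_diag dg.lin_d]])
    show "r \<in> kspan (words ?V F)"
      using that by (simp add: free_operad_def)
    show "tensor_diff F d' (?D (bas w)) = ?D (d' (bas w))" if "w \<in> words ?V F" for w
      by (rule dg.diff_diag_word[OF G lessI words_homog[OF that]])
  qed
  ultimately show ?thesis
    by (intro exI[of _ ?D]) blast
qed

end
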